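(* Let $D<n$ be positive integers, such that $D\in\omega(\log^2 n)$. Let $0<\alpha<1/2$ be a constant and let $\tau=\lfloor\alpha D\rfloor$. There exist trees $T$ with size $\Theta(n)$, diameter $D$, and $\xi(T)\le\tau$, for which any leader election algorithm working in time $\tau$ requires advice of size $\Omega(n)$. That is, there is a class $\mathcal T$ of trees $T$ with size $\Theta(n)$, diameter $D$ and $\xi(T)\le\tau$ such that every leader election algorithm with advice working in time $\tau$ on $\mathcal T$ requires advice of size $\Omega(n)$.
   Context: Trees are finite, undirected and anonymous (nodes have no labels), and are port-numbered: at each node $v$ of degree $d$ the incident edges carry distinct port numbers from $\{0,\dots,d-1\}$; there is no relation between the two port numbers of an edge at its two endpoints. The size of a tree is its number of nodes. Leader election in $T$: every node $v$ must output a finite sequence $P(v)=(p_1,\dots,p_k)$ of nonnegative integers (possibly empty). Let $P^*(v)$ be the path starting at $v$ obtained by taking $p_i$ as the outgoing port at the $i$-th node of the path. All $P^*(v)$ must be simple paths in $T$ ending at one common node (the leader). View: $V_T(v,r)$ is the subtree of $T$ induced by all nodes at distance at most $r$ from $v$, rooted at $v$, with all port numbers at these nodes and with the degrees of all nodes at distance exactly $r$ from $v$ (views are identified up to root- and port-preserving isomorphism). Deterministic algorithm with advice (LOCAL model): an oracle knowing $T$ assigns to $T$ one binary string $A(T)$, given to all nodes at the start; the size of advice for $T$ is the length of $A(T)$. After each round $r\ge 0$, each node $v$ that has not yet halted decides, as a function of $V_T(v,r)$ and $A(T)$ only, whether to halt and what to output. The algorithm works in time $\tau$ on a class if it solves leader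 election in every tree of the class with all nodes halting in rounds at most $\tau$. It "requires advice of size $\Omega(L)$" on the class if $\max_{T\in\mathcal T}|A(T)|\in\Omega(L)$. All algorithms are deterministic. $\xi(T)$ is the minimum time in which leader election in $T$ is feasible when each node is given the entire port-numbered map of $T$ (without its own position marked), i.e., the smallest $\tau\ge 0$ for which there is a valid assignment of outputs in $T$ in which the output of each node $v$ depends only on $V_T(v,\tau)$. Asymptotic convention: $D=D(n)$ is a function of $n$ with $D(n)/\log^2 n\to\infty$; the statements hold for all sufficiently large $n$, with implied constants allowed to depend on $\alpha$. *)

theory Defs
  imports Complex_Main "HOL-Library.Landau_Symbols" "HOL-Library.Extended_Nat"
begin

section \<open>Port-numbered trees\<close>

text \<open>
  The neighbours of a node are listed in the order of its ports: port \<open>p\<close> of \<open>v\<close> leads to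
  \<open>nbrs T v ! p\<close>.  Hence the ports at \<open>v\<close> are exactly \<open>0, \<dots>, deg T v - 1\<close>, and the two port
  numbers of an edge are unrelated.  The elements of \<open>nodes T\<close> only serve to write \<open>T\<close> down;
  anonymity is expressed below by invariance under isomorphism of views.
\<close>

record 'a port_graph =
  nodes :: "'a set"
  nbrs :: "'a \<Rightarrow> 'a list"

definition deg :: "'a port_graph \<Rightarrow> 'a \<Rightarrow> nat" where
  "deg T v = length (nbrs T v)"

definition edges :: "'a port_graph \<Rightarrow> ('a \<times> 'a) set" where
  "edges T = {(u, v). u \<in> nodes T \<and> v \<in> set (nbrs T u)}"

definition simple_graph :: "'a port_graph \<Rightarrow> bool" where
  "simple_graph T \<longleftrightarrow> finite (nodes T) \<and> nodes T \<noteq> {} \<and> sym (edges T) \<and>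
     (\<forall>v\<in>nodes T. distinct (nbrs T v) \<and> set (nbrs T v) \<subseteq> nodes T - {v})"

definition connected_graph :: "'a port_graph \<Rightarrow> bool" where
  "connected_graph T \<longleftrightarrow> (\<forall>u\<in>nodes T. \<forall>v\<in>nodes T. (u, v) \<in> (edges T)\<^sup>*)"

definition is_cycle :: "'a port_graph \<Rightarrow> 'a list \<Rightarrow> bool" where
  "is_cycle T c \<longleftrightarrow> length c \<ge> 3 \<and> distinct c \<and>
     (\<forall>i<length c. (c ! i, c ! (Suc i mod length c)) \<in> edges T)"

definition port_tree :: "'a port_graph \<Rightarrow> bool" where
  "port_tree T \<longleftrightarrow> simple_graph T \<and> connected_graph T \<and> (\<nexists>c. is_cycle T c)"

definition tree_size :: "'a port_graph \<Rightarrow> nat" where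
  "tree_size T = card (nodes T)"

definition tree_dist :: "'a port_graph \<Rightarrow> 'a \<Rightarrow> 'a \<Rightarrow> nat" where
  "tree_dist T u v = (LEAST k. (u, v) \<in> edges T ^^ k)"

definition tree_diameter :: "'a port_graph \<Rightarrow> nat" where
  "tree_diameter T = Max {tree_dist T u v | u v. u \<in> nodes T \<and> v \<in> nodes T}"

section \<open>Leader election\<close>

text \<open>
  \<open>path_of T v ps\<close> is the sequence of nodes visited from \<open>v\<close> when leaving the successive nodes by
  the ports \<open>ps\<close>; it is \<open>None\<close> if one of these ports does not exist.
\<close>

fun path_of :: "'a port_graph \<Rightarrow> 'a \<Rightarrow> nat list \<Rightarrow> 'a list option" where
  "path_of T v [] = Some [v]"
| "path_of T v (p # ps) =
     (if p < deg T v then map_option (Cons v) (path_of T (nbrs T v ! p) ps) else None)"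

definition leader_election :: "'a port_graph \<Rightarrow> ('a \<Rightarrow> nat list) \<Rightarrow> bool" where
  "leader_election T P \<longleftrightarrow> (\<exists>l\<in>nodes T. \<forall>v\<in>nodes T.
     \<exists>xs. path_of T v (P v) = Some xs \<and> distinct xs \<and> last xs = l)"

section \<open>Views\<close>

text \<open>
  A triple \<open>(x, p, y)\<close> in \<open>vlinks\<close> says that port \<open>p\<close> of \<open>x\<close> leads to \<open>y\<close>; \<open>vdeg\<close> is defined only
  on the nodes at distance exactly \<open>r\<close> from the root.
\<close>

record 'a view =
  vroot :: 'a
  vnodes :: "'a set"
  vlinks :: "('a \<times> nat \<times> 'a) set"
  vdeg :: "'a \<Rightarrow> nat option"

definition view_of :: "'a port_graph \<Rightarrow> 'a \<Rightarrow> nat \<Rightarrow> 'a view" where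
  "view_of T v r =
     (let B = {x \<in> nodes T. tree_dist T v x \<le> r} in
      \<lparr> vroot = v,
        vnodes = B,
        vlinks = {(x, p, y). x \<in> B \<and> y \<in> B \<and> p < deg T x \<and> nbrs T x ! p = y},
        vdeg = (\<lambda>x. if x \<in> nodes T \<and> tree_dist T v x = r then Some (deg T x) else None) \<rparr>)"

definition view_iso :: "'a view \<Rightarrow> 'b view \<Rightarrow> bool" where
  "view_iso V W \<longleftrightarrow> (\<exists>f. bij_betw f (vnodes V) (vnodes W) \<and> f (vroot V) = vroot W \<and>
     (\<forall>x\<in>vnodes V. \<forall>y\<in>vnodes V. \<forall>p. (x, p, y) \<in> vlinks V \<longleftrightarrow> (f x, p, f y) \<in> vlinks W) \<and>
     (\<forall>x\<in>vnodes V. vdeg W (f x) = vdeg V x))"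

text \<open>
  Time feasibility when the whole map of \<open>T\<close> is known.  The infimum in \<^typ>\<open>enat\<close> is the minimum,
  and it is \<open>\<infinity>\<close> for trees in which no leader can be elected in any time.
\<close>

definition xi :: "'a port_graph \<Rightarrow> enat" where
  "xi T = Inf (enat ` {t. \<exists>P. leader_election T P \<and>
     (\<forall>u\<in>nodes T. \<forall>v\<in>nodes T. view_iso (view_of T u t) (view_of T v t) \<longrightarrow> P u = P v)})"

section \<open>Algorithms with advice\<close>

text \<open>
  Every finite tree has a copy with nodes in \<^typ>\<open>nat\<close>.  Given a view and the advice, an algorithm
  either does not halt (\<open>None\<close>) or halts and outputs a sequence of ports.
\<close>

type_synonym algorithm = "nat view \<Rightarrow> bool list \<Rightarrow> nat list option"

definition anonymous :: "algorithm \<Rightarrow> bool" where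
  "anonymous alg \<longleftrightarrow> (\<forall>S T u v r s a.
     port_tree S \<and> port_tree T \<and> u \<in> nodes S \<and> v \<in> nodes T \<and>
     view_iso (view_of S u r) (view_of T v s) \<longrightarrow>
     alg (view_of S u r) a = alg (view_of T v s) a)"

definition halts_with ::
  "algorithm \<Rightarrow> bool list \<Rightarrow> nat port_graph \<Rightarrow> nat \<Rightarrow> nat \<Rightarrow> nat list \<Rightarrow> bool" where
  "halts_with alg a T v r ps \<longleftrightarrow>
     alg (view_of T v r) a = Some ps \<and> (\<forall>r'<r. alg (view_of T v r') a = None)"

definition works_in_time ::
  "algorithm \<Rightarrow> (nat port_graph \<Rightarrow> bool list) \<Rightarrow> nat port_graph set \<Rightarrow> nat \<Rightarrow> bool" where
  "works_in_time alg A \<T> t \<longleftrightarrow> anonymous alg \<and>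
     (\<forall>T\<in>\<T>. \<exists>P. leader_election T P \<and>
        (\<forall>v\<in>nodes T. \<exists>r\<le>t. halts_with alg (A T) T v r (P v)))"

definition advice_size :: "(nat port_graph \<Rightarrow> bool list) \<Rightarrow> nat port_graph set \<Rightarrow> nat" where
  "advice_size A \<T> = Max ((\<lambda>T. length (A T)) ` \<T>)"

end

theory Submission
  imports Defs
begin

text \<open>
  The trees are spiders with about \<open>n / D\<close> arms of length slightly more than \<open>\<tau>\<close> and one long leg
  that stretches the diameter to \<open>D\<close>.  The \<open>m = \<Theta>(D)\<close> nodes of an arm that are nearest to the root
  carry \<open>m\<close> arbitrary bits, written in the order of their two ports; the end of the arm is at
  distance more than \<open>\<tau>\<close> from them, so what it outputs does not depend on these bits.  If the leader
  lies outside the arm, the output of the end of the arm is a simple path through the whole arm and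
  spells the bits out.  Hence the advice determines the bits of all arms but the one containing the
  leader, which gives about \<open>n / D \<cdot> m = \<Theta>(n)\<close> bits of advice.

  In every such tree the root can be elected in time \<open>\<tau>\<close>, because all views of radius \<open>\<tau>\<close> differ:
  an isomorphism of two views of the same tree that fixes one node is the identity, and every node
  sees the root, a leg node of unique degree, or the end of its arm, near which the ports spell out
  the index of the arm.
\<close>

section \<open>Views in simple graphs\<close>

lemma tree_dist_le: "(u, v) \<in> edges T ^^ j \<Longrightarrow> tree_dist T u v \<le> j"
  unfolding tree_dist_def by (rule Least_le)

lemma relpow_edges_tree_dist:
  assumes "connected_graph T" "u \<in> nodes T" "v \<in> nodes T"
  shows "(u, v) \<in> edges T ^^ tree_dist T u v"
proof -
  have "(u, v) \<in> (edges T)\<^sup>*" using assms unfolding connected_graph_def by blast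
  then obtain j where "(u, v) \<in> edges T ^^ j" using rtrancl_imp_relpow by blast
  then show ?thesis unfolding tree_dist_def by (rule LeastI)
qed

lemma relpow_edges_sym:
  assumes "sym (edges T)" "(u, v) \<in> edges T ^^ j"
  shows "(v, u) \<in> edges T ^^ j"
  using assms(2)
proof (induction j arbitrary: v)
  case (Suc j)
  then obtain w where w: "(u, w) \<in> edges T ^^ j" "(w, v) \<in> edges T" by auto
  then have "(v, w) \<in> edges T" "(w, u) \<in> edges T ^^ j"
    using assms(1) Suc.IH by (auto dest: symD)
  then show ?case by (rule relpow_Suc_I2)
qed auto

lemma relpow_edges_nodes:
  assumes "simple_graph T" "u \<in> nodes T" "(u, v) \<in> edges T ^^ j"
  shows "v \<in> nodes T"
  using assms by (cases j) (auto simp: simple_graph_def edges_def)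

lemma relpow_join: "(x, y) \<in> R ^^ i \<Longrightarrow> (y, z) \<in> R ^^ j \<Longrightarrow> (x, z) \<in> R ^^ (i + j)"
  unfolding relpow_add by (rule relcompI)

text \<open>Potentials that change by at most 1 along an edge bound distances from below. This is
  applied to a signed depth for the diameter, and to the depth for what an arm end can see.\<close>

lemma relpow_Lipschitz:
  fixes g :: "'a \<Rightarrow> int"
  assumes "\<And>x y. (x, y) \<in> edges T \<Longrightarrow> \<bar>g x - g y\<bar> \<le> 1" "(u, v) \<in> edges T ^^ j"
  shows "\<bar>g u - g v\<bar> \<le> int j"
  using assms(2)
proof (induction j arbitrary: v)
  case (Suc j)
  then obtain w where w: "(u, w) \<in> edges T ^^ j" "(w, v) \<in> edges T" by auto
  have "\<bar>g u - g w\<bar> \<le> int j" "\<bar>g w - g v\<bar> \<le> 1"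
    using w Suc.IH assms(1) by auto
  then show ?case by linarith
qed auto

text \<open>A view lists degrees only on its boundary sphere, so interior degrees have to be
  recovered from the links.\<close>

definition vports :: "'a view \<Rightarrow> 'a \<Rightarrow> nat set" where
  "vports V x = {p. \<exists>y. (x, p, y) \<in> vlinks V}"

text \<open>All neighbours of a node strictly inside the ball still lie in the ball, so none of its
  ports is cut off.\<close>

lemma vports_interior:
  assumes "simple_graph T" "connected_graph T" "u \<in> nodes T" "x \<in> nodes T" "tree_dist T u x < r"
  shows "vports (view_of T u r) x = {..<deg T x}"
proof -
  have "nbrs T x ! p \<in> nodes T \<and> tree_dist T u (nbrs T x ! p) \<le> r" if "p < deg T x" for p
  proof -
    have e: "(x, nbrs T x ! p) \<in> edges T"
      using that assms unfolding edges_def deg_def by auto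
    then have "(u, nbrs T x ! p) \<in> edges T ^^ Suc (tree_dist T u x)"
      using relpow_edges_tree_dist[OF assms(2,3,4)] by auto
    then have "tree_dist T u (nbrs T x ! p) \<le> Suc (tree_dist T u x)" by (rule tree_dist_le)
    moreover have "nbrs T x ! p \<in> nodes T"
      using that assms(1,4) by (auto simp: simple_graph_def deg_def dest!: nth_mem)
    ultimately show ?thesis using assms(5) by auto
  qed
  then show ?thesis using assms(4,5) unfolding vports_def view_of_def Let_def by auto
qed

section \<open>Isomorphisms between two views of the same tree\<close>

locale view_isomorphism =
  fixes T :: "'a port_graph" and u v :: 'a and r :: nat and f :: "'a \<Rightarrow> 'a"
  assumes simple: "simple_graph T" and connected: "connected_graph T"
    and u: "u \<in> nodes T" and v: "v \<in> nodes T"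
    and bij: "bij_betw f (vnodes (view_of T u r)) (vnodes (view_of T v r))"
    and root: "f u = v"
    and links: "\<And>x p y. x \<in> vnodes (view_of T u r) \<Longrightarrow> y \<in> vnodes (view_of T u r) \<Longrightarrow>
       (x, p, y) \<in> vlinks (view_of T u r) \<longleftrightarrow> (f x, p, f y) \<in> vlinks (view_of T v r)"
    and degs: "\<And>x. x \<in> vnodes (view_of T u r) \<Longrightarrow>
       vdeg (view_of T v r) (f x) = vdeg (view_of T u r) x"
begin

definition ball :: "'a set" where "ball = {x \<in> nodes T. tree_dist T u x \<le> r}"

lemma vnodes_u: "vnodes (view_of T u r) = ball"
  unfolding ball_def view_of_def Let_def by simp

lemma ballI: "(u, x) \<in> edges T ^^ j \<Longrightarrow> j \<le> r \<Longrightarrow> x \<in> ball"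
  using tree_dist_le relpow_edges_nodes[OF simple u] unfolding ball_def by fastforce

lemma link:
  assumes "x \<in> ball" "y \<in> ball" "p < deg T x" "nbrs T x ! p = y"
  shows "p < deg T (f x) \<and> nbrs T (f x) ! p = f y"
proof -
  have "(x, p, y) \<in> vlinks (view_of T u r)"
    using assms unfolding ball_def view_of_def Let_def by auto
  then have "(f x, p, f y) \<in> vlinks (view_of T v r)" using links assms vnodes_u by auto
  then show ?thesis unfolding view_of_def Let_def by auto
qed

text \<open>In a view, \<open>vdeg\<close> is \<open>None\<close> exactly off the sphere of radius
  \<open>r\<close>, so \<open>f\<close> keeps interior nodes interior. There the degree can be read
  from the links, which \<open>f\<close> preserves.\<close>

lemma deg_f:
  assumes x: "x \<in> nodes T" and d: "tree_dist T u x < r"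
  shows "f x \<in> nodes T \<and> deg T (f x) = deg T x"
proof -
  have xb: "x \<in> vnodes (view_of T u r)" using assms vnodes_u ball_def by auto
  then have fx: "f x \<in> vnodes (view_of T v r)" using bij by (auto simp: bij_betw_def)
  then have fn: "f x \<in> nodes T" "tree_dist T v (f x) \<le> r" unfolding view_of_def Let_def by auto
  have "vdeg (view_of T v r) (f x) = None"
    using degs[OF xb] d unfolding view_of_def Let_def by auto
  then have "tree_dist T v (f x) \<noteq> r" using fn unfolding view_of_def Let_def by auto
  then have d': "tree_dist T v (f x) < r" using fn by simp
  have sub: "x \<in> vnodes W \<and> y \<in> vnodes W"
    if "(x, p, y) \<in> vlinks W" "W = view_of T w r" for W x p y w
    using that unfolding view_of_def Let_def by auto
  have "vports (view_of T u r) x = vports (view_of T v r) (f x)"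
  proof (intro equalityI subsetI)
    fix p assume "p \<in> vports (view_of T u r) x"
    then show "p \<in> vports (view_of T v r) (f x)"
      using links sub unfolding vports_def by blast
  next
    fix p assume "p \<in> vports (view_of T v r) (f x)"
    then obtain z where z: "(f x, p, z) \<in> vlinks (view_of T v r)" unfolding vports_def by auto
    then obtain y where "y \<in> vnodes (view_of T u r)" "z = f y"
      using sub[OF z refl] bij by (auto simp: bij_betw_def)
    then show "p \<in> vports (view_of T u r) x"
      using z links xb unfolding vports_def by blast
  qed
  then have "{..<deg T x} = {..<deg T (f x)}"
    using vports_interior[OF simple connected u x d] vports_interior[OF simple connected v fn(1) d']
    by simp
  then show ?thesis using fn by simp
qed

text \<open>Ports determine neighbours: if \<open>f\<close> fixes a node, it fixes the neighbours in
  the ball as well. Going back along the walk shows that \<open>f\<close> fixes \<open>u\<close>,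
  while \<open>f u = v\<close>.\<close>

lemma fixed_point:
  assumes "(u, x) \<in> edges T ^^ j" "j \<le> r" "f x = x"
  shows "u = v"
  using assms
proof (induction j arbitrary: x)
  case 0
  then show ?case using root by auto
next
  case (Suc j)
  then obtain w where w: "(u, w) \<in> edges T ^^ j" "(w, x) \<in> edges T" by auto
  have b: "w \<in> ball" "x \<in> ball"
    using ballI[OF w(1)] ballI[OF Suc.prems(1)] Suc.prems(2) by auto
  have "(x, w) \<in> edges T" using w simple by (auto simp: simple_graph_def dest: symD)
  then obtain p where p: "p < deg T x" "nbrs T x ! p = w"
    unfolding edges_def deg_def by (auto simp: in_set_conv_nth)
  have "nbrs T (f x) ! p = f w" using link[OF b(2,1) p] by simp
  then have "f w = w" using p Suc.prems by simp
  then show ?case using Suc w by simp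
qed

end

section \<open>Rooted trees given by a parent function\<close>

definition kids :: "nat set \<Rightarrow> nat \<Rightarrow> (nat \<Rightarrow> nat) \<Rightarrow> nat \<Rightarrow> nat list" where
  "kids S rt par v = sorted_list_of_set {w \<in> S. w \<noteq> rt \<and> par w = v}"

text \<open>The flag \<open>b\<close> only reorders ports: the edge to the parent gets the last port
  or port 0. At a node with a single child this is one free bit, and the underlying graph does not
  depend on it.\<close>

definition rooted_tree :: "nat set \<Rightarrow> nat \<Rightarrow> (nat \<Rightarrow> nat) \<Rightarrow> (nat \<Rightarrow> bool) \<Rightarrow> nat port_graph" where
  "rooted_tree S rt par b = \<lparr> nodes = S,
     nbrs = (\<lambda>v. if v = rt then kids S rt par v
                 else if b v then kids S rt par v @ [par v] else par v # kids S rt par v) \<rparr>"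

locale parent_tree =
  fixes S :: "nat set" and rt :: nat and par :: "nat \<Rightarrow> nat" and dep :: "nat \<Rightarrow> nat"
  assumes fin: "finite S" and rt: "rt \<in> S"
    and par: "\<And>v. v \<in> S \<Longrightarrow> v \<noteq> rt \<Longrightarrow> par v \<in> S \<and> dep v = Suc (dep (par v))"
    and dep_rt: "dep rt = 0"
begin

abbreviation "T b \<equiv> rooted_tree S rt par b"

lemma par_in: "v \<in> S \<Longrightarrow> v \<noteq> rt \<Longrightarrow> par v \<in> S"
  using par by blast

lemma nodes_T [simp]: "nodes (T b) = S"
  by (simp add: rooted_tree_def)

lemma set_kids [simp]: "set (kids S rt par v) = {w \<in> S. w \<noteq> rt \<and> par w = v}"
  unfolding kids_def using fin by simp

lemma edges_T: "edges (T b) = {(u, v). u \<in> S \<and> v \<in> S \<and> (v \<noteq> rt \<and> par v = u \<or> u \<noteq> rt \<and> par u = v)}"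
proof -
  have "v \<in> set (nbrs (T b) u) \<longleftrightarrow> v \<in> S \<and> (v \<noteq> rt \<and> par v = u \<or> u \<noteq> rt \<and> par u = v)"
    if "u \<in> S" for u v
    using par_in[OF that] set_kids[of u] by (cases "u = rt") (auto simp: rooted_tree_def)
  then show ?thesis unfolding edges_def by auto
qed

lemma simple_T: "simple_graph (T b)"
proof -
  \<comment> \<open>The second claim keeps the parent out of the list of children, as distinctness
    of the neighbours demands.\<close>
  have *: "par v \<noteq> v" "par (par v) \<noteq> v \<or> par v = rt" if "v \<in> S" "v \<noteq> rt" for v
  proof -
    have 1: "par v \<in> S" "dep v = Suc (dep (par v))" using par[OF that] by blast+
    then show "par v \<noteq> v" by (metis n_not_Suc_n)
    have "dep (par v) = Suc (dep (par (par v)))" if "par v \<noteq> rt" using par 1 that by blast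
    then show "par (par v) \<noteq> v \<or> par v = rt" using 1(2) by (metis Suc_n_not_le_n le_Suc_eq order_refl)
  qed
  have d: "distinct (kids S rt par v)" for v unfolding kids_def by simp
  have "distinct (nbrs (T b) v) \<and> set (nbrs (T b) v) \<subseteq> S - {v}" if "v \<in> S" for v
  proof (cases "v = rt")
    case True
    then show ?thesis using d *(1) by (auto simp: rooted_tree_def)
  next
    case False
    then show ?thesis using d *[OF that False] *(1) par_in[OF that False]
      by (auto simp: rooted_tree_def)
  qed
  moreover have "sym (edges (T b))" unfolding edges_T sym_def by auto
  moreover have "finite (nodes (T b))" "nodes (T b) \<noteq> {}" using fin rt by auto
  ultimately show ?thesis unfolding simple_graph_def by simp
qed

lemma parent_edge: "v \<in> S \<Longrightarrow> v \<noteq> rt \<Longrightarrow> (v, par v) \<in> edges (T b)"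
  using par_in[of v] unfolding edges_T by auto

lemma path_to_root: "v \<in> S \<Longrightarrow> (v, rt) \<in> edges (T b) ^^ dep v"
proof (induction "dep v" arbitrary: v)
  case 0
  then have "v = rt" using par[of v] by fastforce
  then show ?case using dep_rt by simp
next
  case (Suc d)
  then have "v \<noteq> rt" using dep_rt by auto
  then have *: "par v \<in> S" "dep v = Suc (dep (par v))" using par[of v] Suc.prems by auto
  then have "d = dep (par v)" using Suc.hyps(2) by simp
  then have "(par v, rt) \<in> edges (T b) ^^ dep (par v)" using Suc.hyps(1) *(1) by blast
  then show ?case
    unfolding *(2) using parent_edge[OF Suc.prems \<open>v \<noteq> rt\<close>] by (rule relpow_Suc_I2[rotated])
qed

lemma sym_T: "sym (edges (T b))"
  using simple_T unfolding simple_graph_def by auto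

lemma connected_T: "connected_graph (T b)"
  unfolding connected_graph_def
proof (intro ballI)
  fix u v assume "u \<in> nodes (T b)" "v \<in> nodes (T b)"
  then have uv: "u \<in> S" "v \<in> S" by auto
  have "(u, rt) \<in> (edges (T b))\<^sup>*"
    using path_to_root[OF uv(1)] by (rule relpow_imp_rtrancl)
  moreover have "(rt, v) \<in> (edges (T b))\<^sup>*"
    using relpow_edges_sym[OF sym_T path_to_root[OF uv(2)]] by (rule relpow_imp_rtrancl)
  ultimately show "(u, v) \<in> (edges (T b))\<^sup>*" by (rule rtrancl_trans)
qed

text \<open>On a cycle, a node of maximal depth would have its parent on both sides.\<close>

lemma acyclic_T: "\<not> is_cycle (T b) c"
proof
  assume c: "is_cycle (T b) c"
  let ?n = "length c"
  have n: "?n \<ge> 3" and dis: "distinct c"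
    and e: "\<And>i. i < ?n \<Longrightarrow> (c ! i, c ! (Suc i mod ?n)) \<in> edges (T b)"
    using c unfolding is_cycle_def by blast+
  have "set c \<noteq> {}" using n by (cases c) auto
  then have "Max (dep ` set c) \<in> dep ` set c" by (intro Max_in) auto
  then obtain x where x: "x \<in> set c" "dep x = Max (dep ` set c)" by force
  have mx: "dep y \<le> dep x" if "y \<in> set c" for y using x that by simp
  obtain i where i: "i < ?n" "c ! i = x" using x by (auto simp: in_set_conv_nth)
  define j where "j = (if i = 0 then ?n - 1 else i - 1)"
  have j: "j < ?n" "Suc j mod ?n = i" using i n unfolding j_def by auto
  have up: "par x = y" if "(x, y) \<in> edges (T b) \<or> (y, x) \<in> edges (T b)" "y \<in> set c" for y
  proof (rule ccontr)
    assume "par x \<noteq> y"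
    then have "y \<in> S" "y \<noteq> rt" "par y = x" using that(1) unfolding edges_T by auto
    then have "dep y = Suc (dep x)" using par[of y] by blast
    then show False using mx[OF that(2)] by simp
  qed
  define l where "l = Suc i mod ?n"
  have l: "l < ?n" unfolding l_def using i by (auto intro: mod_less_divisor)
  have "par x = c ! j" using up[of "c ! j"] e[OF j(1)] j i by auto
  moreover have "par x = c ! l" using up[of "c ! l"] e[OF i(1)] l i unfolding l_def by auto
  ultimately have "j = l" using dis j l by (simp add: nth_eq_iff_index_eq)
  then show False using i n unfolding j_def l_def
    by (cases "Suc i = ?n") (auto split: if_splits)
qed

lemma port_tree_T: "port_tree (T b)"
  unfolding port_tree_def using simple_T connected_T acyclic_T by auto

section \<open>Electing the root\<close>

fun up_ports :: "(nat \<Rightarrow> bool) \<Rightarrow> nat \<Rightarrow> nat \<Rightarrow> nat list" where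
  "up_ports b 0 v = []"
| "up_ports b (Suc d) v = (if b v then length (kids S rt par v) else 0) # up_ports b d (par v)"

text \<open>Every step lowers the depth by one, so no node repeats. The depth bound and
  \<open>xs \<noteq> []\<close> are there for the induction, which prepends \<open>v\<close> to a
  path of smaller depths.\<close>

lemma up_ports_path:
  assumes "v \<in> S"
  shows "\<exists>xs. path_of (T b) v (up_ports b (dep v) v) = Some xs \<and> distinct xs \<and> last xs = rt \<and>
    xs \<noteq> [] \<and> (\<forall>x\<in>set xs. dep x \<le> dep v)"
  using assms
proof (induction "dep v" arbitrary: v)
  case 0
  then have "v = rt" using par[of v] by fastforce
  then show ?case using dep_rt by simp
next
  case (Suc d)
  then have "v \<noteq> rt" using dep_rt by auto
  then have *: "par v \<in> S" "dep v = Suc (dep (par v))" using par[of v] Suc.prems by auto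
  then have "d = dep (par v)" using Suc.hyps(2) by simp
  then obtain xs where xs: "path_of (T b) (par v) (up_ports b (dep (par v)) (par v)) = Some xs"
    "distinct xs" "last xs = rt" "xs \<noteq> []" "\<forall>x\<in>set xs. dep x \<le> dep (par v)"
    using Suc.hyps(1)[of "par v"] *(1) by blast
  have "path_of (T b) v (up_ports b (dep v) v) = Some (v # xs)"
    using xs(1) *(2) \<open>v \<noteq> rt\<close> by (auto simp: deg_def rooted_tree_def nth_append)
  then show ?case using xs *(2) by fastforce
qed

lemma leader_root: "leader_election (T b) (\<lambda>v. up_ports b (dep v) v)"
  unfolding leader_election_def nodes_T using rt up_ports_path by blast

text \<open>If isomorphic views force equal nodes, every assignment of outputs depends on the view
  only, in particular the one that elects the root.\<close>

lemma xi_le: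
  assumes "\<And>u v f. view_isomorphism (T b) u v r f \<Longrightarrow> u = v"
  shows "xi (T b) \<le> enat r"
proof -
  have "u = v" if uv: "u \<in> S" "v \<in> S" "view_iso (view_of (T b) u r) (view_of (T b) v r)" for u v
  proof -
    have rt: "vroot (view_of (T b) w r) = w" for w by (simp add: view_of_def Let_def)
    obtain f where f: "bij_betw f (vnodes (view_of (T b) u r)) (vnodes (view_of (T b) v r))"
      "f u = v"
      "\<forall>x\<in>vnodes (view_of (T b) u r). \<forall>y\<in>vnodes (view_of (T b) u r). \<forall>p.
        (x, p, y) \<in> vlinks (view_of (T b) u r) \<longleftrightarrow> (f x, p, f y) \<in> vlinks (view_of (T b) v r)"
      "\<forall>x\<in>vnodes (view_of (T b) u r). vdeg (view_of (T b) v r) (f x) = vdeg (view_of (T b) u r) x"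
      using uv(3) unfolding view_iso_def rt by blast
    have "view_isomorphism (T b) u v r f"
      using f uv(1,2) simple_T connected_T by unfold_locales auto
    then show ?thesis by (rule assms)
  qed
  then show ?thesis unfolding xi_def
    by (intro Inf_lower imageI) (auto intro!: exI[of _ "\<lambda>v. up_ports b (dep v) v"] leader_root)
qed

lemma tree_diameter_eq:
  assumes "\<And>u v. u \<in> S \<Longrightarrow> v \<in> S \<Longrightarrow> tree_dist (T b) u v \<le> d"
    and "u \<in> S" "v \<in> S" "d \<le> tree_dist (T b) u v"
  shows "tree_diameter (T b) = d"
proof -
  let ?M = "{tree_dist (T b) u v | u v. u \<in> nodes (T b) \<and> v \<in> nodes (T b)}"
  have "?M = (\<lambda>(u, v). tree_dist (T b) u v) ` (S \<times> S)" by auto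
  then have "finite ?M" using fin by simp
  moreover have "tree_dist (T b) u v = d" using assms by (simp add: antisym)
  then have "d \<in> ?M" using assms(2,3) by auto
  ultimately show ?thesis unfolding tree_diameter_def
    using assms(1) by (intro Max_eqI) auto
qed

end

section \<open>The spiders\<close>

text \<open>
  The root \<open>node 0 0 0\<close> carries one leg (index \<open>0\<close>) of length \<open>L\<close> and arms \<open>1, \<dots>, k\<close> of length
  \<open>a\<close>.  Spine nodes are \<open>node i t 0\<close>, at distance \<open>t\<close> from the root; \<open>node i t y\<close> with \<open>y > 0\<close> is a
  leaf hung on \<open>node i t 0\<close>.  These leaves give the root, the leg nodes at multiples of \<open>h\<close> and the
  class of all arm ends recognizable degrees.
\<close>

definition node :: "nat \<Rightarrow> nat \<Rightarrow> nat \<Rightarrow> nat" where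
  "node i t y = prod_encode (i, prod_encode (t, y))"

lemma node_eq [simp]: "node i t y = node i' t' y' \<longleftrightarrow> i = i' \<and> t = t' \<and> y = y'"
  by (auto simp: node_def)

definition npar :: "nat \<Rightarrow> nat" where
  "npar v = (case prod_decode v of (i, w) \<Rightarrow> case prod_decode w of (t, y) \<Rightarrow>
     if y > 0 then node i t 0 else if t \<le> 1 then node 0 0 0 else node i (t - 1) 0)"

definition ndep :: "nat \<Rightarrow> nat" where
  "ndep v = (case prod_decode v of (i, w) \<Rightarrow> case prod_decode w of (t, y) \<Rightarrow>
     if y > 0 then Suc t else t)"

definition narm :: "nat \<Rightarrow> nat" where
  "narm v = fst (prod_decode v)"

lemma npar_node [simp]: "npar (node i t y) =
    (if y > 0 then node i t 0 else if t \<le> 1 then node 0 0 0 else node i (t - 1) 0)"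
  by (simp add: npar_def node_def)

lemma ndep_node [simp]: "ndep (node i t y) = (if y > 0 then Suc t else t)"
  by (simp add: ndep_def node_def)

lemma narm_node [simp]: "narm (node i t y) = i"
  by (simp add: narm_def node_def)

text \<open>The bound on \<open>k\<close> makes the index of an arm fit into the \<tau> - 2 bits
  readable near its end. By \<open>m + 2 \<le> \<tau>\<close>, arm nodes at depth at least \<tau>
  are at distance less than \<tau> from the arm end. The bound on \<open>L\<close> makes the leg at
  least as deep as the leaves at the arm ends.\<close>

locale spider =
  fixes k m L \<tau> :: nat
  assumes k_pos: "0 < k" and k: "k < 2 ^ (\<tau> - 2)" and m: "m + 2 \<le> \<tau>" and \<tau>: "4 \<le> \<tau>"
    and L: "\<tau> + m + 2 \<le> L"
begin

text \<open>The arm end is at distance \<tau> + 1 from depth \<open>m\<close>, just too far to see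
  the data.\<close>

definition a :: nat where "a = \<tau> + m + 1"
text \<open>One less than \<tau>, to leave room for the step from a leaf to the spine before walking
  to the nearest marker.\<close>

definition h :: nat where "h = \<tau> - 1"

text \<open>Degree 3 is reserved for the arm ends. The leg markers get the degrees
  \<open>t div h + 3\<close>, which are at least 4, and the \<open>L + 3\<close> leaves put the root
  above all of them.\<close>

definition pend :: "nat \<Rightarrow> nat \<Rightarrow> nat" where
  "pend i t = (if i = 0 then if t = 0 then L + 3 else if t < L \<and> h dvd t then t div h + 1 else 0
               else if t = a then 2 else 0)"

definition spine :: "nat \<Rightarrow> nat \<Rightarrow> bool" where
  "spine i t \<longleftrightarrow> i = 0 \<and> t \<le> L \<or> 1 \<le> i \<and> i \<le> k \<and> 1 \<le> t \<and> t \<le> a"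

definition S :: "nat set" where
  "S = {node i t y | i t y. spine i t \<and> y \<le> pend i t}"

text \<open>
  On the arms, the ports at depth at most \<open>m\<close> carry the data \<open>X\<close>, the remaining ones the binary
  expansion of the index of the arm.
\<close>

definition swap :: "(nat \<times> nat) set \<Rightarrow> nat \<Rightarrow> bool" where
  "swap X v = (case prod_decode v of (i, w) \<Rightarrow> case prod_decode w of (t, y) \<Rightarrow>
     i \<ge> 1 \<and> (if t \<le> m then (i, t) \<in> X else t < a \<and> bit i (a - t - 1)))"

lemma swap_node: "swap X (node i t y) \<longleftrightarrow>
    i \<ge> 1 \<and> (if t \<le> m then (i, t) \<in> X else t < a \<and> bit i (a - t - 1))"
  by (simp add: swap_def node_def)

lemma node_S: "node i t y \<in> S \<longleftrightarrow> spine i t \<and> y \<le> pend i t"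
  unfolding S_def by auto

lemma S_cases:
  assumes "v \<in> S"
  obtains i t y where "v = node i t y" "spine i t" "y \<le> pend i t"
  using assms unfolding S_def by auto

lemma S_subset:
  "S \<subseteq> (\<lambda>y. node 0 0 y) ` {..L + 3} \<union> (\<lambda>(t, y). node 0 t y) ` ({1..L} \<times> {..L div h + 1}) \<union>
     (\<lambda>(i, t, y). node i t y) ` ({1..k} \<times> {1..a} \<times> {..2})"
proof
  fix v assume "v \<in> S"
  then obtain i t y where v: "v = node i t y" "spine i t" "y \<le> pend i t" by (rule S_cases)
  have "t div h \<le> L div h" if "t \<le> L" using that by (rule div_le_mono)
  then consider "i = 0" "t = 0" "y \<le> L + 3" | "i = 0" "t \<in> {1..L}" "y \<le> L div h + 1"
    | "i \<in> {1..k}" "t \<in> {1..a}" "y \<le> 2"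
    using v(2,3) unfolding spine_def pend_def by (fastforce split: if_splits)
  then show "v \<in> (\<lambda>y. node 0 0 y) ` {..L + 3} \<union>
      (\<lambda>(t, y). node 0 t y) ` ({1..L} \<times> {..L div h + 1}) \<union>
      (\<lambda>(i, t, y). node i t y) ` ({1..k} \<times> {1..a} \<times> {..2})"
    using v(1) by cases (auto simp: image_iff)
qed

lemma finite_S: "finite S"
  by (rule finite_subset[OF S_subset]) auto

text \<open>The summands count the root with its leaves, the rest of the leg, and the arms. The
  middle one will be linear because \<open>L div h\<close> is bounded in terms of \<alpha>.\<close>

lemma card_S_le: "card S \<le> (L + 4) + L * (L div h + 2) + 3 * (k * a)"
proof -
  have "card S \<le> card ((\<lambda>y. node 0 0 y) ` {..L + 3} \<union>
      (\<lambda>(t, y). node 0 t y) ` ({1..L} \<times> {..L div h + 1}) \<union>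
      (\<lambda>(i, t, y). node i t y) ` ({1..k} \<times> {1..a} \<times> {..2}))"
    by (rule card_mono[OF _ S_subset]) auto
  also have "\<dots> \<le> card ((\<lambda>y. node 0 0 y) ` {..L + 3}) +
      card ((\<lambda>(t, y). node 0 t y) ` ({1..L} \<times> {..L div h + 1})) +
      card ((\<lambda>(i, t, y). node i t y) ` ({1..k} \<times> {1..a} \<times> {..2}))"
    by (meson card_Un_le add_le_mono le_trans order_refl)
  also have "\<dots> \<le> card {..L + 3} + card ({1..L} \<times> {..L div h + 1}) +
      card ({1..k} \<times> {1..a} \<times> {..2::nat})"
    by (intro add_mono card_image_le) auto
  finally show ?thesis by (simp add: card_cartesian_product)
qed

lemma card_S_ge: "k * a \<le> card S"
proof -
  have "inj_on (\<lambda>(i, t). node i t 0) ({1..k} \<times> {1..a})" by (auto simp: inj_on_def)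
  then have "card ((\<lambda>(i, t). node i t 0) ` ({1..k} \<times> {1..a})) = k * a"
    by (simp add: card_image card_cartesian_product)
  moreover have "(\<lambda>(i, t). node i t 0) ` ({1..k} \<times> {1..a}) \<subseteq> S"
    by (auto simp: node_S spine_def)
  ultimately show ?thesis using card_mono[OF finite_S] by metis
qed

abbreviation root :: nat where "root \<equiv> node 0 0 0"

sublocale parent_tree S root npar ndep
proof
  show "finite S" by (rule finite_S)
  show "root \<in> S" by (simp add: node_S spine_def)
  show "ndep root = 0" by simp
  fix v assume v: "v \<in> S" "v \<noteq> root"
  obtain i t y where "v = node i t y" "spine i t" "y \<le> pend i t" using v(1) by (rule S_cases)
  then show "npar v \<in> S \<and> ndep v = Suc (ndep (npar v))"
    using v(2) by (auto simp: node_S spine_def)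
qed

abbreviation G :: "(nat \<times> nat) set \<Rightarrow> nat port_graph" where "G X \<equiv> T (swap X)"
abbreviation kid :: "nat \<Rightarrow> nat list" where "kid \<equiv> kids S root npar"

section \<open>Degrees as landmarks\<close>

lemma length_kid: "length (kid v) = card {w \<in> S. w \<noteq> root \<and> npar w = v}"
  unfolding kids_def by simp

lemma deg_G: "v \<noteq> root \<Longrightarrow> deg (G X) v = Suc (length (kid v))"
  "deg (G X) root = length (kid root)"
  unfolding deg_def by (auto simp: rooted_tree_def)

lemma kid_leaf: "y > 0 \<Longrightarrow> kid (node i t y) = []"
proof -
  assume "y > 0"
  then have "{w \<in> S. w \<noteq> root \<and> npar w = node i t y} = {}"
    by (auto elim!: S_cases split: if_splits)
  then show ?thesis unfolding kids_def by (simp only: sorted_list_of_set_empty)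
qed

lemma kid_set:
  assumes "t > 0"
  shows "{w \<in> S. w \<noteq> root \<and> npar w = node i t 0} =
    (if spine i t then node i t ` {1..pend i t} else {}) \<union>
    (if spine i (Suc t) then {node i (Suc t) 0} else {})"
  using assms by (auto simp: node_S elim!: S_cases split: if_splits)

lemma kid_arm:
  assumes "1 \<le> i" "i \<le> k" "1 \<le> t" "t < a"
  shows "kid (node i t 0) = [node i (Suc t) 0]"
proof -
  have "{w \<in> S. w \<noteq> root \<and> npar w = node i t 0} = {node i (Suc t) 0}"
    using assms by (subst kid_set) (auto simp: spine_def pend_def)
  then show ?thesis unfolding kids_def by simp
qed

lemma card_leaves: "card (node i t ` {1..n}) = n"
  by (subst card_image) (auto simp: inj_on_def)

lemma deg_arm_end: "1 \<le> i \<Longrightarrow> i \<le> k \<Longrightarrow> deg (G X) (node i a 0) = 3"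
proof -
  assume i: "1 \<le> i" "i \<le> k"
  have "{w \<in> S. w \<noteq> root \<and> npar w = node i a 0} = node i a ` {1..2}"
    using i by (subst kid_set) (auto simp: spine_def pend_def a_def)
  then have "length (kid (node i a 0)) = 2" by (simp only: length_kid card_leaves)
  then show ?thesis using i by (simp add: deg_G)
qed

lemma deg_leg:
  assumes "1 \<le> t" "t < L"
  shows "deg (G X) (node 0 t 0) = pend 0 t + 2"
proof -
  have "{w \<in> S. w \<noteq> root \<and> npar w = node 0 t 0} = node 0 t ` {1..pend 0 t} \<union> {node 0 (Suc t) 0}"
    using assms by (subst kid_set) (auto simp: spine_def)
  moreover have "card (node 0 t ` {1..pend 0 t} \<union> {node 0 (Suc t) 0}) = pend 0 t + 1"
    by (subst card_Un_disjoint) (auto simp: card_leaves[simplified])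
  ultimately show ?thesis using assms by (simp add: deg_G length_kid)
qed

lemma deg_leg_end: "deg (G X) (node 0 L 0) = 1"
proof -
  have "{w \<in> S. w \<noteq> root \<and> npar w = node 0 L 0} = {}"
    using L by (subst kid_set) (auto simp: spine_def pend_def)
  then have "length (kid (node 0 L 0)) = 0" by (simp only: length_kid card.empty)
  then show ?thesis using L by (simp add: deg_G)
qed

lemma deg_leaf: "y > 0 \<Longrightarrow> deg (G X) (node i t y) = 1"
  by (simp add: deg_G kid_leaf)

lemma deg_root: "L + 3 \<le> deg (G X) root"
proof -
  have "node 0 0 ` {1..L + 3} \<subseteq> {w \<in> S. w \<noteq> root \<and> npar w = root}"
    by (auto simp: node_S spine_def pend_def)
  then have "card (node 0 0 ` {1..L + 3}) \<le> card {w \<in> S. w \<noteq> root \<and> npar w = root}"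
    using finite_S by (intro card_mono) auto
  then show ?thesis by (simp only: deg_G length_kid card_leaves)
qed

lemma S_degree_cases:
  assumes "v \<in> S"
  obtains (root) "v = root"
  | (marker) t where "v = node 0 t 0" "1 \<le> t" "t < L" "h dvd t" "deg (G X) v = t div h + 3"
  | (arm_end) i where "v = node i a 0" "1 \<le> i" "i \<le> k" "deg (G X) v = 3"
  | (plain) "deg (G X) v \<le> 2"
proof -
  obtain i t y where v: "v = node i t y" "spine i t" "y \<le> pend i t" using assms by (rule S_cases)
  consider "y > 0" | "y = 0" "i = 0" "t = 0" | "y = 0" "i = 0" "1 \<le> t" "t < L" "h dvd t"
    | "y = 0" "i = 0" "1 \<le> t" "t < L" "\<not> h dvd t" | "y = 0" "i = 0" "t = L"
    | "y = 0" "1 \<le> i" "i \<le> k" "1 \<le> t" "t < a" | "y = 0" "1 \<le> i" "i \<le> k" "t = a"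
    using v(2) unfolding spine_def One_nat_def Suc_le_eq by (metis gr0I le_neq_implies_less)
  then show ?thesis
  proof cases
    case 1 then show ?thesis using v(1) deg_leaf by (intro plain) simp
  next
    case 2 then show ?thesis using v(1) by (intro root) simp
  next
    case 3 then show ?thesis using v(1) deg_leg by (intro marker) (auto simp: pend_def)
  next
    case 4 then show ?thesis using v(1) deg_leg by (intro plain) (auto simp: pend_def)
  next
    case 5 then show ?thesis using v(1) deg_leg_end by (intro plain) simp
  next
    case 6 then show ?thesis using v(1) kid_arm by (intro plain) (simp add: deg_G)
  next
    case 7 then show ?thesis using v(1) deg_arm_end by (intro arm_end) auto
  qed
qed

lemma h_pos: "0 < h"
  using \<tau> by (simp add: h_def)

text \<open>Markers are multiples of \<open>h\<close>, hence determined by their quotient; and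
  \<open>t div h \<le> t < L\<close> keeps their degrees below that of the root.\<close>

lemma deg_unique:
  assumes "v \<in> S" "w \<in> S" "deg (G X) v = deg (G X) w" "4 \<le> deg (G X) v"
  shows "v = w"
proof -
  have *: "deg (G X) root \<noteq> t div h + 3" if "t < L" for t
    using deg_root[of X] that div_le_dividend[of t h] by linarith
  show ?thesis using assms(1)
  proof (cases rule: S_degree_cases[where X = X])
    case root
    show ?thesis using assms(2)
      by (cases rule: S_degree_cases[where X = X]) (use assms root *[symmetric] in auto)
  next
    case (marker t)
    show ?thesis using assms(2)
    proof (cases rule: S_degree_cases[where X = X])
      case root
      then show ?thesis using marker *[of t] assms(3) by simp
    next
      case m: (marker t')
      then have "t div h = t' div h" using marker assms by simp
      then show ?thesis using marker m by (metis dvd_div_mult_self)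
    qed (use marker assms in auto)
  qed (use assms in auto)
qed

lemma deg_three:
  assumes "v \<in> S" "deg (G X) v = 3"
  obtains i where "v = node i a 0" "1 \<le> i" "i \<le> k"
  using assms(1)
proof (cases rule: S_degree_cases[where X = X])
  case root
  then show ?thesis using deg_root[of X] assms L by simp
next
  case (marker t)
  then have "1 \<le> t div h" using h_pos by (auto simp: div_greater_zero_iff Suc_le_eq dvd_imp_le)
  then show ?thesis using marker assms by simp
qed (use assms that in auto)

text \<open>The root has index 0, so on an arm the coordinates describe the walk only until just
  before the root; hence the strict bound there.\<close>

lemma spine_up:
  assumes "spine i t" "d < t \<or> i = 0 \<and> d \<le> t"
  shows "(node i t 0, node i (t - d) 0) \<in> edges (G X) ^^ d"
  using assms(2)
proof (induction d)
  case (Suc d)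
  then have "(node i t 0, node i (t - d) 0) \<in> edges (G X) ^^ d" by auto
  moreover have "(node i (t - d) 0, npar (node i (t - d) 0)) \<in> edges (G X)"
    using Suc.prems assms(1) by (intro parent_edge) (auto simp: node_S spine_def)
  moreover have "npar (node i (t - d) 0) = node i (t - Suc d) 0" using Suc.prems by auto
  ultimately show ?case by auto
qed auto

lemma leaf_spine:
  assumes "node i t y \<in> S"
  shows "(node i t y, node i t 0) \<in> edges (G X) ^^ (if y > 0 then 1 else 0)"
proof (cases "y > 0")
  case True
  then have "(node i t y, npar (node i t y)) \<in> edges (G X)"
    using assms by (intro parent_edge) auto
  then show ?thesis using True by simp
qed simp

end

section \<open>Diameter and time feasibility\<close>

context spider
begin

text \<open>Folds the spider onto a line, the leg on the positive side and the arms on the negative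
  one.\<close>

definition height :: "nat \<Rightarrow> int" where
  "height v = (if narm v = 0 then int (ndep v) else - int (ndep v))"

lemma height_Lipschitz:
  assumes "(x, y) \<in> edges (G X)"
  shows "\<bar>height x - height y\<bar> \<le> 1" "\<bar>int (ndep x) - int (ndep y)\<bar> \<le> 1"
proof -
  have *: "\<bar>height (npar v) - height v\<bar> \<le> 1 \<and> \<bar>int (ndep (npar v)) - int (ndep v)\<bar> \<le> 1"
    if "v \<in> S" "v \<noteq> root" for v
    using that(1) by (rule S_cases) (use that(2) in \<open>auto simp: height_def spine_def pend_def\<close>)
  show "\<bar>height x - height y\<bar> \<le> 1" "\<bar>int (ndep x) - int (ndep y)\<bar> \<le> 1"
    using assms *[of x] *[of y] unfolding edges_T by fastforce+
qed

lemma ndep_le: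
  assumes "v \<in> S"
  shows "ndep v \<le> (if narm v = 0 then L else a + 1)"
  using assms
proof (rule S_cases)
  fix i t y assume *: "v = node i t y" "spine i t" "y \<le> pend i t"
  \<comment> \<open>A leaf on the leg hangs above the leg end and so is no deeper than it.\<close>
  have "0 < t \<Longrightarrow> t < L \<Longrightarrow> Suc t \<le> L" by simp
  then show ?thesis using * L by (auto simp: spine_def pend_def split: if_splits)
qed

text \<open>For two nodes of the leg the detour through the root may exceed the diameter, so the
  route along the leg is needed.\<close>

lemma tree_dist_leg_le:
  assumes v: "v = node 0 t y" "v \<in> S" and w: "w = node 0 t' y'" "w \<in> S" and le: "t \<le> t'"
  shows "tree_dist (G X) v w \<le> ndep w + 1"
proof -
  let ?E = "edges (G X)"
  have "spine 0 t'" using w by (simp add: node_S)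
  then have "(node 0 t' 0, node 0 t 0) \<in> ?E ^^ (t' - t)"
    using spine_up[of 0 t' "t' - t"] le by simp
  with leaf_spine[OF w(2)[unfolded w(1)]]
  have "(w, node 0 t 0) \<in> ?E ^^ ((if y' > 0 then 1 else 0) + (t' - t))"
    unfolding w(1) by (rule relpow_join)
  moreover have "(node 0 t 0, v) \<in> ?E ^^ (if y > 0 then 1 else 0)"
    using relpow_edges_sym[OF sym_T leaf_spine[of 0 t y]] v by simp
  ultimately have "(w, v) \<in> ?E ^^ ((if y' > 0 then 1 else 0) + (t' - t) + (if y > 0 then 1 else 0))"
    by (rule relpow_join)
  then have "tree_dist (G X) v w \<le> (if y' > 0 then 1 else 0) + (t' - t) + (if y > 0 then 1 else 0)"
    by (rule tree_dist_le[OF relpow_edges_sym[OF sym_T]])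
  also have "\<dots> \<le> ndep w + 1" using w by auto
  finally show ?thesis .
qed

lemma diameter: "tree_diameter (G X) = L + a + 1"
proof (rule tree_diameter_eq)
  let ?E = "edges (G X)"
  fix v w assume vw: "v \<in> S" "w \<in> S"
  have "(v, w) \<in> ?E ^^ (ndep v + ndep w)"
    using path_to_root[OF vw(1)] relpow_edges_sym[OF sym_T path_to_root[OF vw(2)]]
    by (rule relpow_join)
  then have d: "tree_dist (G X) v w \<le> ndep v + ndep w" by (rule tree_dist_le)
  have sym: "tree_dist (G X) v w = tree_dist (G X) w v"
    unfolding tree_dist_def using relpow_edges_sym[OF sym_T] by (metis (no_types, lifting))
  show "tree_dist (G X) v w \<le> L + a + 1"
  proof (cases "narm v = 0 \<and> narm w = 0")
    case True
    obtain i t y where v: "v = node i t y" using vw(1) by (rule S_cases)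
    obtain j t' y' where w: "w = node j t' y'" using vw(2) by (rule S_cases)
    have "tree_dist (G X) v w \<le> max (ndep v) (ndep w) + 1"
    proof (cases "t \<le> t'")
      case le: True
      have "tree_dist (G X) v w \<le> ndep w + 1"
        by (rule tree_dist_leg_le[OF _ vw(1) _ vw(2) le]) (use v w True in auto)
      then show ?thesis by simp
    next
      case False
      have "tree_dist (G X) w v \<le> ndep v + 1"
        by (rule tree_dist_leg_le[OF _ vw(2) _ vw(1), of t' y' t y]) (use v w True False in auto)
      then show ?thesis using sym by simp
    qed
    then show ?thesis using ndep_le[OF vw(1)] ndep_le[OF vw(2)] True by simp
  next
    case False
    then show ?thesis
      using d ndep_le[OF vw(1)] ndep_le[OF vw(2)] L by (auto simp: a_def split: if_splits)
  qed
next
  \<comment> \<open>The extremal pair is the leg end and a leaf at the end of arm 1; their heights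
    differ by \<open>L + a + 1\<close>.\<close>
  let ?v = "node 0 L 0" and ?w = "node 1 a 1"
  show S: "?v \<in> S" "?w \<in> S" using k_pos by (auto simp: node_S spine_def pend_def a_def)
  have "(?v, ?w) \<in> edges (G X) ^^ tree_dist (G X) ?v ?w"
    using relpow_edges_tree_dist[OF connected_T] S by simp
  then have "\<bar>height ?v - height ?w\<bar> \<le> int (tree_dist (G X) ?v ?w)"
    by (rule relpow_Lipschitz[rotated]) (rule height_Lipschitz)
  then show "L + a + 1 \<le> tree_dist (G X) ?v ?w" by (simp add: height_def)
qed

text \<open>Walking up from \<open>v\<close> meets the root or a marker. The strict bound
  \<open>j < \<tau>\<close> puts it in the interior of the view, where isomorphisms preserve
  degrees.\<close>

lemma landmark_near:
  assumes "v = node i t y" "v \<in> S" "i = 0 \<or> t < \<tau>"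
  shows "\<exists>x j. x \<in> S \<and> (v, x) \<in> edges (G X) ^^ j \<and> j < \<tau> \<and> 4 \<le> deg (G X) x"
proof -
  let ?y = "if y > 0 then 1 else 0 :: nat"
  let ?E = "edges (G X)"
  have sp: "spine i t" "y \<le> pend i t" using assms by (auto simp: node_S)
  have leaf: "(v, node i t 0) \<in> ?E ^^ ?y" using leaf_spine assms(1,2) by simp
  have join: "(v, x) \<in> ?E ^^ (?y + d)" if "(node i t 0, x) \<in> ?E ^^ d" for x d
    using leaf that by (rule relpow_join)
  show ?thesis
  proof (cases "i = 0 \<and> h \<le> t")
    case False
    have "(node i t 0, root) \<in> ?E ^^ t" using path_to_root[of "node i t 0"] sp by (simp add: node_S)
    then have "(v, root) \<in> ?E ^^ (?y + t)" by (rule join)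
    moreover have "?y + t < \<tau>"
    proof (cases "i = 0")
      case True
      then show ?thesis using \<open>\<not> (i = 0 \<and> h \<le> t)\<close> by (auto simp: h_def)
    next
      case False
      then have "t < \<tau>" using assms(3) by simp
      then show ?thesis using False sp by (simp add: pend_def a_def)
    qed
    moreover have "root \<in> S" by (simp add: node_S spine_def)
    moreover have "4 \<le> deg (G X) root" using deg_root[of X] L by simp
    ultimately show ?thesis by blast
  next
    case True
    \<comment> \<open>The leg end is never a marker, so from \<open>t = L\<close> the rounding
      starts at \<open>L - 1\<close>. The additional step is affordable because the leg end carries
      no leaf.\<close>
    define t' where "t' = (if t = L then L - 1 else t)"
    define s where "s = h * (t' div h)"
    have hL: "h \<le> L - 1" using L by (simp add: h_def)
    have tL: "t \<le> L" using sp True by (simp add: spine_def)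
    have t': "h \<le> t'" "t' < L" "t' \<le> t" using True hL tL h_pos L by (auto simp: t'_def)
    have "1 \<le> t' div h" using t'(1) h_pos by (simp add: div_greater_zero_iff Suc_le_eq)
    then have s: "h \<le> s" "s \<le> t'" "h dvd s" "t' - s < h"
      using h_pos by (auto simp: s_def minus_mult_div_eq_mod)
    have "(node i t 0, node i (t - (t - s)) 0) \<in> ?E ^^ (t - s)"
      using True by (intro spine_up sp) auto
    then have "(node i t 0, node 0 s 0) \<in> ?E ^^ (t - s)" using True s t' by simp
    then have "(v, node 0 s 0) \<in> ?E ^^ (?y + (t - s))" by (rule join)
    moreover have "?y + (t - s) < \<tau>"
    proof (cases "t = L")
      case tt: True
      then have "y = 0" using sp True L by (simp add: pend_def)
      then show ?thesis using s(4) tt by (simp add: t'_def h_def)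
    next
      case False
      then show ?thesis using s(4) by (auto simp: t'_def h_def)
    qed
    moreover have "node 0 s 0 \<in> S" using s t' by (simp add: node_S spine_def)
    moreover have "4 \<le> deg (G X) (node 0 s 0)"
      using deg_leg[of s X] s t' h_pos dvd_imp_le[of h s] by (simp add: pend_def div_greater_zero_iff Suc_le_eq)
    ultimately show ?thesis by blast
  qed
qed

end

section \<open>Reading off the arms\<close>

text \<open>Distances depend on the edges only, so reordering ports outside the ball does not affect
  the view.\<close>

lemma view_of_cong:
  assumes "nodes T = nodes T'" "edges T = edges T'"
    and "\<And>x. x \<in> nodes T \<Longrightarrow> tree_dist T v x \<le> r \<Longrightarrow> nbrs T x = nbrs T' x"
  shows "view_of T v r = view_of T' v r"
proof -
  have d: "tree_dist T = tree_dist T'" using assms(2) by (auto simp: tree_dist_def fun_eq_iff)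
  have "deg T x = deg T' x" if "x \<in> nodes T" "tree_dist T v x \<le> r" for x
    using assms(3)[OF that] by (simp add: deg_def)
  then show ?thesis
    using assms(3) unfolding view_of_def Let_def assms(1)[symmetric] d[symmetric]
    by (auto simp: fun_eq_iff)
qed

lemma path_of_hd: "path_of T v ps = Some xs \<Longrightarrow> xs \<noteq> [] \<and> hd xs = v"
  by (cases ps) (auto split: if_splits)

lemma bit_eq_nat:
  fixes i j :: nat
  assumes "i < 2 ^ l" "j < 2 ^ l" "\<And>n. n < l \<Longrightarrow> bit i n = bit j n"
  shows "i = j"
proof -
  have "take_bit l i = take_bit l j"
    using assms(3) by (intro bit_eqI) (auto simp: bit_take_bit_iff)
  then show ?thesis using assms(1,2) by (simp add: take_bit_nat_eq_self)
qed

context spider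
begin

section \<open>Distinctness of the views of radius \<open>\<tau>\<close>\<close>

lemma nbrs_arm:
  assumes "1 \<le> i" "i \<le> k" "1 \<le> t" "t < a"
  shows "nbrs (G X) (node i t 0) =
    (if swap X (node i t 0) then [node i (Suc t) 0, npar (node i t 0)]
     else [npar (node i t 0), node i (Suc t) 0])"
  using assms kid_arm[OF assms] by (simp add: rooted_tree_def)

lemma nbrs_arm_end:
  assumes "1 \<le> i"
  shows "nbrs (G X) (node i a 0) = node i (a - 1) 0 # kid (node i a 0)"
  using assms \<tau> by (simp add: rooted_tree_def swap_node a_def)

text \<open>The matching of the two arm ends propagates towards the root: at each node the port back
  to the child, already matched, reveals the bit, and then the other port matches the
  parents.\<close>

lemma arm_walk:
  assumes iso: "view_isomorphism (G X) u v \<tau> f"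
    and i: "1 \<le> i" "i \<le> k" and j: "1 \<le> j" "j \<le> k"
    and ball: "\<And>d. d < \<tau> \<Longrightarrow> node i (a - d) 0 \<in> view_isomorphism.ball (G X) u \<tau>"
    and e: "f (node i a 0) = node j a 0"
    and "d < \<tau>"
  shows "f (node i (a - d) 0) = node j (a - d) 0 \<and>
    (0 < d \<and> Suc d < \<tau> \<longrightarrow> swap X (node i (a - d) 0) = swap X (node j (a - d) 0))"
  using \<open>d < \<tau>\<close>
proof (induction d rule: less_induct)
  case (less d)
  interpret view_isomorphism "G X" u v \<tau> f by (rule iso)
  have am: "d < a" "1 < a - d" using less.prems m by (auto simp: a_def)
  have F: "f (node i (a - d) 0) = node j (a - d) 0"
  proof (cases d)
    case 0
    then show ?thesis using e by simp
  next
    case (Suc c)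
    show ?thesis
    proof (cases "c = 0")
      \<comment> \<open>The arm end stores no bit: its port 0 always leads to the parent.\<close>
      case True
      have "nbrs (G X) (f (node i a 0)) ! 0 = f (node i (a - 1) 0)"
        using link[OF ball[of 0] ball[of 1], of 0] i \<tau> nbrs_arm_end[OF i(1), of X]
        by (simp add: deg_def)
      then show ?thesis using nbrs_arm_end[OF j(1), of X] e Suc True by simp
    next
      case False
      let ?x = "node i (a - c) 0" and ?x' = "node j (a - c) 0"
      have fx: "f ?x = ?x'" and sw: "swap X ?x = swap X ?x'"
        using less.IH[of c] Suc False less.prems by auto
      have c: "1 \<le> a - c" "a - c < a" "\<not> a - c \<le> 1" "a - c - 1 = a - d"
        using am Suc False by auto
      define p where "p = (if swap X ?x then 1 else 0 :: nat)"
      have "nbrs (G X) ?x ! p = node i (a - d) 0" "p < deg (G X) ?x"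
        using nbrs_arm[OF i c(1,2), of X] c unfolding p_def deg_def by auto
      then have "nbrs (G X) ?x' ! p = f (node i (a - d) 0)"
        using link[OF ball[of c] ball[of d], of p] fx Suc less.prems by simp
      moreover have "nbrs (G X) ?x' ! p = node j (a - d) 0"
        using nbrs_arm[OF j c(1,2), of X] c sw unfolding p_def by auto
      ultimately show ?thesis by simp
    qed
  qed
  moreover have "swap X (node i (a - d) 0) = swap X (node j (a - d) 0)" if d: "0 < d"
  proof -
    let ?x = "node i (a - d) 0" and ?x' = "node j (a - d) 0"
    have c: "1 \<le> a - d" "a - d < a" "Suc (a - d) = a - (d - 1)" using am d by auto
    \<comment> \<open>The port from \<open>?x\<close> back to its child. It must lead to the child
      of \<open>?x'\<close> too, which forces the same port order.\<close>
    define p where "p = (if swap X ?x then 0 else 1 :: nat)"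
    have "nbrs (G X) ?x ! p = node i (a - (d - 1)) 0" "p < deg (G X) ?x"
      using nbrs_arm[OF i c(1,2), of X] c(3) unfolding p_def deg_def by auto
    then have "nbrs (G X) ?x' ! p = f (node i (a - (d - 1)) 0)"
      using link[OF ball[of d] ball[of "d - 1"], of p] F less.prems by simp
    also have "\<dots> = node j (a - (d - 1)) 0" using less.IH[of "d - 1"] d less.prems by simp
    finally have eq: "nbrs (G X) ?x' ! p = node j (Suc (a - d)) 0" using c(3) by simp
    have "npar ?x' \<noteq> node j (Suc (a - d)) 0" by (simp, arith)
    then show ?thesis
      using eq nbrs_arm[OF j c(1,2), of X] unfolding p_def by (auto split: if_splits)
  qed
  ultimately show ?case by blast
qed

text \<open>One fixed point of \<open>f\<close> in the view suffices: a landmark of unique degree if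
  one is near, otherwise the end of the arm, once its image is known to belong to the same
  arm.\<close>

lemma views_unique:
  assumes iso: "view_isomorphism (G X) u v \<tau> f"
  shows "u = v"
proof -
  interpret view_isomorphism "G X" u v \<tau> f by (rule iso)
  have uS: "u \<in> S" using u by simp
  obtain i t y where uv: "u = node i t y" "spine i t" "y \<le> pend i t" using uS by (rule S_cases)
  show ?thesis
  proof (cases "i = 0 \<or> t < \<tau>")
    case True
    obtain x j where x: "x \<in> S" "(u, x) \<in> edges (G X) ^^ j" "j < \<tau>" "4 \<le> deg (G X) x"
      using landmark_near[OF uv(1) uS True, of X] by blast
    have "tree_dist (G X) u x < \<tau>" using tree_dist_le[OF x(2)] x(3) by simp
    then have "f x \<in> S" "deg (G X) (f x) = deg (G X) x" using deg_f[of x] x(1) by auto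
    then have "f x = x" using deg_unique[of "f x" x X] x(1,4) by simp
    then show ?thesis using fixed_point[OF x(2)] x(3) by simp
  next
    case False
    then have i: "1 \<le> i" "i \<le> k" and t: "\<tau> \<le> t" "t \<le> a" using uv(2) by (auto simp: spine_def)
    let ?E = "edges (G X)"
    let ?y = "if y > 0 then 1 else 0 :: nat"
    have y: "y = 0 \<or> t = a" using uv(3) i by (auto simp: pend_def split: if_splits)
    have leaf: "(u, node i t 0) \<in> ?E ^^ ?y" using leaf_spine uS uv(1) by simp
    have sp: "spine i s" if "1 \<le> s" "s \<le> a" for s using that i by (simp add: spine_def)
    have down: "(u, node i s 0) \<in> ?E ^^ (?y + (s - t))" if s: "t \<le> s" "s \<le> a" for s
    proof -
      have "(node i s 0, node i (s - (s - t)) 0) \<in> ?E ^^ (s - t)"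
        using s t \<tau> by (intro spine_up sp) auto
      then have "(node i t 0, node i s 0) \<in> ?E ^^ (s - t)"
        using s relpow_edges_sym[OF sym_T, of "node i s 0" "node i t 0" "s - t"] by simp
      with leaf show ?thesis by (rule relpow_join)
    qed
    \<comment> \<open>The view contains all arm nodes at distance less than \<tau> from the arm end:
      those below \<open>u\<close> since \<open>a - t \<le> m + 1\<close>, those above since they
      are no further from \<open>u\<close> than allowed by the distance to the end.\<close>
    have "node i s 0 \<in> ball" if s: "a - s < \<tau>" "s \<le> a" "1 \<le> s" for s
    proof (cases "t \<le> s")
      case True
      show ?thesis using down[OF True s(2)] by (rule ballI) (use s t y m a_def in auto)
    next
      case False
      have "(node i t 0, node i (t - (t - s)) 0) \<in> ?E ^^ (t - s)"
        using s t \<tau> False by (intro spine_up sp) auto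
      then have "(node i t 0, node i s 0) \<in> ?E ^^ (t - s)" using False by simp
      with leaf have "(u, node i s 0) \<in> ?E ^^ (?y + (t - s))" by (rule relpow_join)
      then show ?thesis by (rule ballI) (use s t False in auto)
    qed
    then have ball: "node i (a - d) 0 \<in> ball" if "d < \<tau>" for d using that by (simp add: a_def)
    have e: "(u, node i a 0) \<in> ?E ^^ (?y + (a - t))" using down t by simp
    have e': "?y + (a - t) < \<tau>" using y t m by (auto simp: a_def)
    have "tree_dist (G X) u (node i a 0) < \<tau>" using tree_dist_le[OF e] e' by simp
    moreover have "node i a 0 \<in> S" using i by (simp add: node_S spine_def a_def)
    ultimately have "f (node i a 0) \<in> S" "deg (G X) (f (node i a 0)) = 3"
      using deg_f[of "node i a 0"] deg_arm_end[OF i] by auto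
    then obtain j where j: "f (node i a 0) = node j a 0" "1 \<le> j" "j \<le> k" by (rule deg_three)
    have "i = j"
    proof (rule bit_eq_nat)
      show "i < 2 ^ (\<tau> - 2)" "j < 2 ^ (\<tau> - 2)" using i j k by auto
      \<comment> \<open>Bit \<open>n\<close> of the index sits at distance \<open>n + 1\<close> from
        the arm end.\<close>
      fix n assume n: "n < \<tau> - 2"
      have "swap X (node i (a - Suc n) 0) = swap X (node j (a - Suc n) 0)"
        using arm_walk[OF iso i j(2,3) ball j(1), of "Suc n"] n by simp
      moreover have "\<not> a - Suc n \<le> m" "a - Suc n < a" "a - (a - Suc n) - 1 = n"
        using n by (auto simp: a_def)
      ultimately show "bit i n = bit j n" using i j by (simp add: swap_node)
    qed
    then show ?thesis using fixed_point[OF e] e' j(1) by simp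
  qed
qed

lemma feasible: "xi (G X) \<le> enat \<tau>"
  by (rule xi_le) (rule views_unique)

section \<open>Recovering the data from the output of an arm end\<close>

text \<open>Depth changes by at most 1 per edge, so everything visible from the arm end has depth
  greater than \<open>m\<close>, where no port depends on the data.\<close>

lemma view_arm_end:
  assumes i: "1 \<le> i" "i \<le> k" and r: "r \<le> \<tau>"
  shows "view_of (G X) (node i a 0) r = view_of (G X') (node i a 0) r"
proof (rule view_of_cong)
  show "nodes (G X) = nodes (G X')" "edges (G X) = edges (G X')" by (auto simp: edges_T)
  fix x assume x: "x \<in> nodes (G X)" and d: "tree_dist (G X) (node i a 0) x \<le> r"
  have "(node i a 0, x) \<in> edges (G X) ^^ tree_dist (G X) (node i a 0) x"
    using relpow_edges_tree_dist[OF connected_T] x i by (simp add: node_S spine_def a_def)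
  then have "\<bar>int (ndep (node i a 0)) - int (ndep x)\<bar> \<le> int (tree_dist (G X) (node i a 0) x)"
    by (rule relpow_Lipschitz[rotated]) (rule height_Lipschitz)
  then have dep: "m < ndep x" using d r by (simp add: a_def)
  have "x \<in> S" using x by simp
  then obtain j t y where "x = node j t y" "spine j t" "y \<le> pend j t" by (rule S_cases)
  then have "swap X x = swap X' x"
    using dep by (cases "j = 0") (auto simp: swap_node pend_def a_def split: if_splits)
  then show "nbrs (G X) x = nbrs (G X') x" by (simp add: rooted_tree_def)
qed

text \<open>A simple path that has entered an arm from its end can only go on towards the root.\<close>

lemma path_up_arm:
  assumes "1 \<le> i" "i \<le> k" "1 \<le> t" "t < a"
    and "path_of (G X) (node i t 0) ps = Some xs" "distinct xs" "node i (Suc t) 0 \<notin> set xs"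
  shows "(length ps < t \<longrightarrow> narm (last xs) = i) \<and>
    (\<forall>s. 1 \<le> s \<and> s \<le> t \<and> t - s < length ps \<longrightarrow>
       ps ! (t - s) = (if swap X (node i s 0) then 1 else 0))"
  using assms(3-)
proof (induction t arbitrary: ps xs)
  case (Suc t)
  let ?v = "node i (Suc t) 0"
  note nb = nbrs_arm[OF assms(1,2) Suc.prems(1,2), of X]
  show ?case
  proof (cases ps)
    case Nil
    then show ?thesis using Suc.prems by auto
  next
    case (Cons p qs)
    then have "p < deg (G X) ?v" using Suc.prems by (auto split: if_splits)
    then obtain ys where ys: "path_of (G X) (nbrs (G X) ?v ! p) qs = Some ys" "xs = ?v # ys"
      using Suc.prems(3) Cons by auto
    have hd: "ys \<noteq> []" "hd ys = nbrs (G X) ?v ! p" using path_of_hd[OF ys(1)] by auto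
    \<comment> \<open>The child is excluded by hypothesis, so the next node is the parent and the
      port used equals the bit.\<close>
    then have "nbrs (G X) ?v ! p \<noteq> node i (Suc (Suc t)) 0"
      using Suc.prems(5) ys(2) by (metis hd_in_set list.set_intros(2))
    moreover have "p = 0 \<or> p = 1"
      using \<open>p < deg (G X) ?v\<close> unfolding deg_def nb by (auto split: if_splits)
    ultimately have p: "p = (if swap X ?v then 1 else 0)" "nbrs (G X) ?v ! p = npar ?v"
      unfolding nb by (auto split: if_splits)
    show ?thesis
    proof (cases "t = 0")
      case True
      then show ?thesis using Cons p(1) by (auto simp: le_Suc_eq)
    next
      case False
      then have "npar ?v = node i t 0" by simp
      then have IH: "(length qs < t \<longrightarrow> narm (last ys) = i) \<and>
          (\<forall>s. 1 \<le> s \<and> s \<le> t \<and> t - s < length qs \<longrightarrow>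
             qs ! (t - s) = (if swap X (node i s 0) then 1 else 0))"
        using Suc.IH[of qs ys] ys p(2) Suc.prems(2,4) False by simp
      have "ps ! (Suc t - s) = (if swap X (node i s 0) then 1 else 0)"
        if s: "1 \<le> s" "s \<le> Suc t" "Suc t - s < length ps" for s
      proof (cases "s = Suc t")
        case True
        then show ?thesis using Cons p(1) by simp
      next
        case False
        then have "Suc t - s = Suc (t - s)" using s by simp
        then have "ps ! (Suc t - s) = qs ! (t - s)" "s \<le> t" "t - s < length qs"
          using s False Cons by auto
        then show ?thesis using conjunct2[OF IH] s(1) by metis
      qed
      moreover have "length ps < Suc t \<longrightarrow> narm (last xs) = i"
        using conjunct1[OF IH] Cons ys(2) hd(1) by simp
      ultimately show ?thesis by blast
    qed
  qed
qed simp

text \<open>Any other port of the arm end leads to a leaf, from which the only continuation returns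
  to the arm end; a simple path could not leave the arm.\<close>

lemma path_from_arm_end:
  assumes i: "1 \<le> i" "i \<le> k"
    and p: "path_of (G X) (node i a 0) ps = Some xs" "distinct xs" "narm (last xs) \<noteq> i"
  shows "ps \<noteq> [] \<and> hd ps = 0"
proof (cases ps)
  case Nil
  then show ?thesis using p by auto
next
  case (Cons q qs)
  let ?e = "node i a 0"
  have "q < deg (G X) ?e" using p Cons by (auto split: if_splits)
  then obtain ys where ys: "path_of (G X) (nbrs (G X) ?e ! q) qs = Some ys" "xs = ?e # ys"
    using p(1) Cons by auto
  have "q = 0"
  proof (rule ccontr)
    assume "q \<noteq> 0"
    then have "nbrs (G X) ?e ! q \<in> set (kid ?e)"
      using \<open>q < deg (G X) ?e\<close> unfolding deg_def nbrs_arm_end[OF i(1)] by (cases q) (auto simp del: set_kids)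
    moreover have "{w \<in> S. w \<noteq> root \<and> npar w = ?e} = node i a ` {1..2}"
      using i by (subst kid_set) (auto simp: spine_def pend_def a_def)
    ultimately have "nbrs (G X) ?e ! q \<in> node i a ` {1..2}" by (simp only: set_kids)
    then obtain y where w: "nbrs (G X) ?e ! q = node i a y" "y > 0" by auto
    show False
    proof (cases qs)
      case Nil
      then show ?thesis using ys w p(3) by auto
    next
      case (Cons q' qs')
      have "nbrs (G X) (node i a y) = [?e]"
        using w(2) kid_leaf[of y i a] i by (simp add: rooted_tree_def)
      then obtain zs where "path_of (G X) ?e qs' = Some zs" "ys = node i a y # zs"
        using ys(1) w(1) Cons by (auto simp: deg_def split: if_splits)
      then have "?e \<in> set ys" using path_of_hd[of "G X" ?e qs' zs] by (metis hd_in_set list.set_intros(2))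
      then show ?thesis using p(2) ys(2) by simp
    qed
  qed
  then show ?thesis using Cons by simp
qed

text \<open>Splits off the first step, so that the rest has the form that \<open>path_up_arm\<close>
  expects: inside the arm, with the child excluded.\<close>

lemma path_after_arm_end:
  assumes i: "1 \<le> i" "i \<le> k"
    and p: "path_of (G X) (node i a 0) ps = Some xs" "distinct xs" "ps \<noteq> []" "hd ps = 0"
  shows "\<exists>ys. path_of (G X) (node i (a - 1) 0) (tl ps) = Some ys \<and> distinct ys \<and>
     node i (Suc (a - 1)) 0 \<notin> set ys \<and> last ys = last xs"
proof -
  let ?e = "node i a 0"
  obtain qs where ps: "ps = 0 # qs" using p(3,4) by (cases ps) auto
  have "0 < deg (G X) ?e" using deg_arm_end[OF i, of X] by simp
  then obtain ys where ys: "path_of (G X) (nbrs (G X) ?e ! 0) qs = Some ys" "xs = ?e # ys"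
    using p(1) ps by auto
  then have "path_of (G X) (node i (a - 1) 0) qs = Some ys"
    using nbrs_arm_end[OF i(1), of X] by simp
  moreover have "Suc (a - 1) = a" by (simp add: a_def)
  moreover have "ys \<noteq> []" using path_of_hd[OF ys(1)] by simp
  ultimately show ?thesis using ps ys(2) p(2) by (intro exI[of _ ys]) auto
qed

text \<open>In both trees the ports spell out the bits they pass. The leader of the first tree being
  outside the arm makes the sequence long enough, and this carries over to the second tree wherever
  its leader is.\<close>

lemma same_ports_same_data:
  assumes i: "1 \<le> i" "i \<le> k"
    and X: "path_of (G X) (node i a 0) ps = Some xs" "distinct xs" "narm (last xs) \<noteq> i"
    and X': "path_of (G X') (node i a 0) ps = Some xs'" "distinct xs'"
    and s: "1 \<le> s" "s \<le> m"
  shows "(i, s) \<in> X \<longleftrightarrow> (i, s) \<in> X'"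
proof -
  have ps: "ps \<noteq> []" "hd ps = 0" using path_from_arm_end[OF i X] by auto
  have a: "1 \<le> a - 1" "a - 1 < a" "s \<le> a - 1" using \<tau> s by (auto simp: a_def)
  obtain ys where ys: "path_of (G X) (node i (a - 1) 0) (tl ps) = Some ys" "distinct ys"
    "node i (Suc (a - 1)) 0 \<notin> set ys" "last ys = last xs"
    using path_after_arm_end[OF i X(1,2) ps] by blast
  obtain zs where zs: "path_of (G X') (node i (a - 1) 0) (tl ps) = Some zs" "distinct zs"
    "node i (Suc (a - 1)) 0 \<notin> set zs"
    using path_after_arm_end[OF i X' ps] by blast
  note Y = path_up_arm[OF i a(1,2) ys(1-3)] and Z = path_up_arm[OF i a(1,2) zs]
  have "a - 1 \<le> length (tl ps)" using conjunct1[OF Y] X(3) ys(4) by (metis not_le)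
  then have len: "a - 1 - s < length (tl ps)" using s a by linarith
  have "tl ps ! (a - 1 - s) = (if swap X (node i s 0) then 1 else 0)"
    "tl ps ! (a - 1 - s) = (if swap X' (node i s 0) then 1 else 0)"
    using spec[OF conjunct2[OF Y], of s] spec[OF conjunct2[OF Z], of s] len s(1) a(3) by simp_all
  then have "swap X (node i s 0) = swap X' (node i s 0)" by (metis zero_neq_one)
  then show ?thesis using i s by (simp add: swap_node)
qed

end

section \<open>Counting advice strings\<close>

text \<open>Equal views up to the earlier halting round make both runs halt in that round.\<close>

lemma halts_with_unique:
  assumes "halts_with alg w T v r ps" "halts_with alg w T' v r' ps'"
    and "\<And>s. s \<le> r \<Longrightarrow> s \<le> r' \<Longrightarrow> view_of T v s = view_of T' v s"
  shows "ps = ps'"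
proof -
  consider "r < r'" | "r' < r" | "r = r'" by linarith
  then show ?thesis
    using assms unfolding halts_with_def by cases auto
qed

lemma card_bool_lists_le: "card {w :: bool list. length w \<le> s} < 2 ^ Suc s"
proof -
  have "card {w :: bool list. length w \<le> s} = (\<Sum>i\<le>s. 2 ^ i)"
    using card_lists_length_le[of "UNIV :: bool set" s] by simp
  also have "\<dots> < 2 ^ Suc s" by (induction s) auto
  finally show ?thesis .
qed

context spider
begin

definition family :: "nat port_graph set" where
  "family = G ` Pow ({1..k} \<times> {1..m})"

lemma finite_family: "finite family" "family \<noteq> {}"
  unfolding family_def by auto

text \<open>Equal advice gives equal outputs at all arm ends, since their views do not depend on the
  data. These outputs determine the data of every arm except possibly one, which leaves at most
  \<open>m\<close> free bits.\<close>

lemma advice_class_small: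
  assumes works: "works_in_time alg A family \<tau>"
  shows "card {X \<in> Pow ({1..k} \<times> {1..m}). A (G X) = w} \<le> 2 ^ m"
proof -
  let ?C = "{X \<in> Pow ({1..k} \<times> {1..m}). A (G X) = w}"
  have "\<exists>P. leader_election (G X) P \<and> (\<forall>v\<in>S. \<exists>r\<le>\<tau>. halts_with alg w (G X) v r (P v))"
    if X: "X \<in> ?C" for X
  proof -
    have "G X \<in> family" "A (G X) = w" using X by (auto simp: family_def)
    then show ?thesis using works unfolding works_in_time_def nodes_T by force
  qed
  then obtain P where *: "\<forall>X\<in>?C. leader_election (G X) (P X) \<and>
      (\<forall>v\<in>S. \<exists>r\<le>\<tau>. halts_with alg w (G X) v r (P X v))"
    using bchoice[of ?C "\<lambda>X P. leader_election (G X) P \<and>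
      (\<forall>v\<in>S. \<exists>r\<le>\<tau>. halts_with alg w (G X) v r (P v))"] by blast
  have P: "leader_election (G X) (P X)"
    "\<And>v. v \<in> S \<Longrightarrow> \<exists>r\<le>\<tau>. halts_with alg w (G X) v r (P X v)" if "X \<in> ?C" for X
    using bspec[OF * that] by blast+
  show ?thesis
  proof (cases "?C = {}")
    case True
    then show ?thesis by (simp only: card.empty)
  next
    case False
    \<comment> \<open>One reference tree with leader \<open>l\<close>: all members of the class are
      compared with it, whatever their own leaders are.\<close>
    then obtain X0 where X0: "X0 \<in> ?C" by blast
    obtain l where l: "\<And>v. v \<in> S \<Longrightarrow>
        \<exists>xs. path_of (G X0) v (P X0 v) = Some xs \<and> distinct xs \<and> last xs = l"
      using P(1)[OF X0] unfolding leader_election_def by auto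
    have agree: "(i, s) \<in> X \<longleftrightarrow> (i, s) \<in> X0"
      if X: "X \<in> ?C" and i: "1 \<le> i" "i \<le> k" "i \<noteq> narm l" and s: "1 \<le> s" "s \<le> m" for X i s
    proof -
      have e: "node i a 0 \<in> S" using i by (simp add: node_S spine_def a_def)
      obtain r r' where r: "r \<le> \<tau>" "halts_with alg w (G X0) (node i a 0) r (P X0 (node i a 0))"
        and r': "r' \<le> \<tau>" "halts_with alg w (G X) (node i a 0) r' (P X (node i a 0))"
        using P(2)[OF X0 e] P(2)[OF X e] by blast
      have eq: "P X0 (node i a 0) = P X (node i a 0)"
        using r(2) r'(2) by (rule halts_with_unique) (use view_arm_end[OF i(1,2)] r(1) in auto)
      obtain xs where xs: "path_of (G X0) (node i a 0) (P X0 (node i a 0)) = Some xs"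
        "distinct xs" "last xs = l" using l[OF e] by blast
      obtain xs' where xs': "path_of (G X) (node i a 0) (P X (node i a 0)) = Some xs'" "distinct xs'"
        using P(1)[OF X] e unfolding leader_election_def by force
      show ?thesis
        using same_ports_same_data[OF i(1,2) xs(1,2) _ xs'(1)[folded eq] xs'(2) s] xs(3) i(3) by simp
    qed
    have "inj_on (\<lambda>X. {s. (narm l, s) \<in> X}) ?C"
    proof (rule inj_onI)
      fix X Y assume XY: "X \<in> ?C" "Y \<in> ?C" and eq: "{s. (narm l, s) \<in> X} = {s. (narm l, s) \<in> Y}"
      have "(i, s) \<in> X \<longleftrightarrow> (i, s) \<in> Y" for i s
      proof (cases "(i, s) \<in> {1..k} \<times> {1..m}")
        case True
        then show ?thesis
          using agree[OF XY(1), of i s] agree[OF XY(2), of i s] eq by (cases "i = narm l") auto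
      next
        case False
        then show ?thesis using XY by blast
      qed
      then show "X = Y" by auto
    qed
    moreover have "(\<lambda>X. {s. (narm l, s) \<in> X}) ` ?C \<subseteq> Pow {1..m}" by auto
    ultimately have "card ?C \<le> card (Pow {1..m})" by (rule card_inj_on_le) simp
    then show ?thesis by (simp add: card_Pow)
  qed
qed

text \<open>Pigeonhole: \<open>2 ^ (k * m)\<close> data sets are split into fewer than
  \<open>2 ^ Suc s\<close> classes of at most \<open>2 ^ m\<close> each, where \<open>s\<close> is
  the advice size.\<close>

lemma advice_lower_bound:
  assumes works: "works_in_time alg A family \<tau>"
  shows "(k - 1) * m \<le> advice_size A family"
proof -
  let ?Q = "Pow ({1..k} \<times> {1..m})"
  let ?s = "advice_size A family"
  let ?W = "(\<lambda>X. A (G X)) ` ?Q"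
  have "length (A T) \<le> ?s" if "T \<in> family" for T
    unfolding advice_size_def using that finite_family(1) by (intro Max_ge) auto
  then have sub: "?W \<subseteq> {w. length w \<le> ?s}" unfolding family_def by blast
  have fin: "finite {w :: bool list. length w \<le> ?s}"
    using finite_lists_length_le[of "UNIV :: bool set" ?s] by simp
  have Q: "?Q = (\<Union>w\<in>?W. {X \<in> ?Q. A (G X) = w})" by blast
  have "2 ^ (k * m) = card ?Q" by (simp add: card_Pow card_cartesian_product)
  also have "\<dots> = card (\<Union>w\<in>?W. {X \<in> ?Q. A (G X) = w})" using Q by (rule arg_cong)
  also have "\<dots> \<le> (\<Sum>w\<in>?W. card {X \<in> ?Q. A (G X) = w})" by (rule card_UN_le) simp
  also have "\<dots> \<le> (\<Sum>w\<in>?W. 2 ^ m)" by (rule sum_mono) (rule advice_class_small[OF works])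
  also have "\<dots> = card ?W * 2 ^ m" by (simp only: sum_constant of_nat_id)
  also have "\<dots> < 2 ^ Suc ?s * 2 ^ m"
    using le_less_trans[OF card_mono[OF fin sub] card_bool_lists_le]
    by (rule mult_strict_right_mono) simp
  finally have "(2::nat) ^ (k * m) < 2 ^ (Suc ?s + m)" unfolding power_add .
  then have "k * m < Suc ?s + m" by (rule power_less_imp_less_exp[rotated]) simp
  then show ?thesis by (simp add: diff_mult_distrib)
qed

end

section \<open>Choice of the parameters\<close>

text \<open>The bound \<open>\<alpha> + 2 * \<delta> \<le> 1 / 2\<close> leaves room in the diameter
  for a sufficiently long leg, \<open>4 \<le> \<delta> * real D\<close> absorbs the rounding, and
  the logarithmic bound lets \<open>k \<le> n\<close> indices be written with \<tau> - 2
  bits.\<close>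

lemma spider_parameters:
  fixes \<alpha> \<delta> :: real and n D :: nat
  assumes \<alpha>: "0 < \<alpha>" and \<delta>: "0 < \<delta>" "2 * \<delta> \<le> \<alpha>" "\<alpha> + 2 * \<delta> \<le> 1 / 2"
    and D: "D < n" "4 \<le> \<delta> * real D" and log: "log 2 (real n) + 3 \<le> \<alpha> * real D"
  shows "\<exists>\<T> :: nat port_graph set. finite \<T> \<and> \<T> \<noteq> {} \<and>
    (\<forall>T\<in>\<T>. port_tree T \<and>
       \<alpha> * real n \<le> real (tree_size T) \<and> real (tree_size T) \<le> (13 + 2 / \<alpha>) * real n \<and>
       tree_diameter T = D \<and> xi T \<le> enat (nat \<lfloor>\<alpha> * real D\<rfloor>)) \<and>
    (\<forall>alg A. works_in_time alg A \<T> (nat \<lfloor>\<alpha> * real D\<rfloor>) \<longrightarrow>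
       \<delta> / 4 * real n \<le> real (advice_size A \<T>))"
proof -
  define \<tau> where "\<tau> = nat \<lfloor>\<alpha> * real D\<rfloor>"
  define m where "m = nat \<lfloor>\<delta> * real D\<rfloor>"
  \<comment> \<open>Adding 1 puts \<open>k * D\<close> between \<open>n\<close> and
    \<open>n + D\<close>, hence below \<open>2 * n\<close>.\<close>
  define k where "k = n div D + 1"
  define L where "L = D - (\<tau> + m + 2)"
  have \<tau>_bounds: "real \<tau> \<le> \<alpha> * real D" "\<alpha> * real D - 1 < real \<tau>"
    using \<alpha> unfolding \<tau>_def by simp_all
  have m_bounds: "real m \<le> \<delta> * real D" "\<delta> * real D - 1 < real m"
    using \<delta>(1) unfolding m_def by simp_all
  have "2 * \<delta> * real D \<le> \<alpha> * real D" using \<delta>(2) by (intro mult_right_mono) auto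
  then have \<alpha>D: "2 * (\<delta> * real D) \<le> \<alpha> * real D" by simp
  have "(\<alpha> + 2 * \<delta>) * real D \<le> 1 / 2 * real D" using \<delta>(3) by (intro mult_right_mono) auto
  then have "2 * (\<alpha> * real D) + 4 * (\<delta> * real D) \<le> real D" by (simp add: algebra_simps)
  \<comment> \<open>The surplus \<open>2 * y \<ge> 8\<close> pays for the additive constant
    4.\<close>
  moreover have "2 * t + 2 * s + 4 \<le> d"
    if "2 * x + 4 * y \<le> d" "t \<le> x" "s \<le> y" "4 \<le> y" for t s x y d :: real
    using that by linarith
  ultimately have "2 * real \<tau> + 2 * real m + 4 \<le> real D" using \<tau>_bounds(1) m_bounds(1) D(2) by blast
  then have "real (2 * (\<tau> + m + 2)) \<le> real D" by simp
  then have half: "2 * (\<tau> + m + 2) \<le> D" by (simp only: of_nat_le_iff)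
  have Dpos: "0 < D" using D(2) by (cases D) auto
  have div: "n < k * D" "k * D \<le> n + D"
    using dividend_less_div_times[OF Dpos, of n] div_times_less_eq_dividend[of n D]
    by (simp_all add: k_def)
  have k1: "1 \<le> n div D" using div_le_mono[of D n D] Dpos D(1) by simp
  have "real 4 \<le> real \<tau>" "real (m + 2) \<le> real \<tau>" using \<tau>_bounds m_bounds \<alpha>D D(2) by auto
  then have \<tau>_ge: "4 \<le> \<tau>" "m + 2 \<le> \<tau>" by (simp_all only: of_nat_le_iff)
  have "k \<le> n"
  proof -
    have "2 * (n div D) \<le> D * (n div D)" using half by (intro mult_right_mono) auto
    also have "\<dots> \<le> n" by simp
    finally show ?thesis using k1 by (simp add: k_def)
  qed
  moreover have "n < 2 ^ (\<tau> - 2)"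
  proof -
    have "log 2 (real n) < real (\<tau> - 2)" using log \<tau>_bounds(2) \<tau>_ge by (simp add: of_nat_diff)
    then have "real n < 2 powr real (\<tau> - 2)" using D(1) by (simp add: log_less_iff)
    then have "real n < real (2 ^ (\<tau> - 2))" by (simp add: powr_realpow)
    then show ?thesis by (simp only: of_nat_less_iff)
  qed
  ultimately interpret spider k m L \<tau>
    using half \<tau>_ge by unfold_locales (auto simp: k_def L_def)
  have diam: "L + a + 1 = D" using half by (simp add: L_def a_def)
  have "real n \<le> real (k * D)" using div(1) by (intro of_nat_mono) simp
  then have "\<alpha> * real n \<le> \<alpha> * (real k * real D)" using \<alpha> by simp
  also have "\<dots> = real k * (\<alpha> * real D)" by simp
  also have "\<dots> \<le> real k * real a" using \<tau>_bounds by (intro mult_left_mono) (auto simp: a_def)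
  also have "\<dots> \<le> real (card S)" using card_S_ge by (metis of_nat_le_iff of_nat_mult)
  finally have lower: "\<alpha> * real n \<le> real (card S)" .
  have "real (card S) \<le> real ((L + 4) + L * (L div h + 2) + 3 * (k * a))"
    using card_S_le by (simp only: of_nat_le_iff)
  also have "\<dots> = (real L + 4) + real L * (real (L div h) + 2) + 3 * real (k * a)" by (simp add: algebra_simps)
  also have "\<dots> \<le> (real n + 4) + real n * (2 / \<alpha> + 2) + 3 * (2 * real n)"
  proof -
    have L: "L \<le> D" "real L \<le> real n" using D(1) by (auto simp: L_def)
    have "\<alpha> * real D / 2 \<le> real h"
      using \<tau>_bounds(2) \<alpha>D D(2) \<tau>_ge by (simp add: h_def of_nat_diff)
    then have "\<alpha> * real D \<le> 2 * real h" by simp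
    moreover have "real (L div h) \<le> real L / real h" by (rule of_nat_div_le_of_nat)
    moreover have "real L / real h \<le> real D / real h" using L(1) by (intro divide_right_mono) auto
    moreover have "real D / real h \<le> 2 / \<alpha>"
      using \<open>\<alpha> * real D \<le> 2 * real h\<close> h_pos \<alpha> by (simp add: field_simps)
    ultimately have "real (L div h) \<le> 2 / \<alpha>" by linarith
    then have "real L * (real (L div h) + 2) \<le> real n * (2 / \<alpha> + 2)"
      using L(2) by (intro mult_mono) auto
    moreover have "k * a \<le> k * D" using half by (intro mult_left_mono) (auto simp: a_def)
    then have "real (k * a) \<le> 2 * real n" using div(2) D(1) by linarith
    ultimately show ?thesis using L(2) by linarith
  qed
  \<comment> \<open>As \<open>n \<ge> 1\<close>, the constant 4 is at most \<open>4 * n\<close>, and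
    1 + 4 + 2 + 6 = 13.\<close>
  also have "\<dots> \<le> (13 + 2 / \<alpha>) * real n" using D(1) Dpos by (simp add: algebra_simps)
  finally have upper: "real (card S) \<le> (13 + 2 / \<alpha>) * real n" .
  have advice: "\<delta> / 4 * real n \<le> real (advice_size A family)"
    if "works_in_time alg A family \<tau>" for alg A
  proof -
    \<comment> \<open>Here \<open>k \<ge> 2\<close>, so giving up the arm of the leader costs at
      most a factor 2.\<close>
    have "k * D \<le> 2 * ((k - 1) * D)" using k1 by (simp add: k_def)
    then have "real n \<le> real (2 * ((k - 1) * D))" using div(1) by linarith
    then have "\<delta> / 4 * real n \<le> \<delta> / 4 * real (2 * ((k - 1) * D))"
      using \<delta>(1) by (intro mult_left_mono) auto
    also have "\<dots> = real (k - 1) * (\<delta> * real D / 2)" by simp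
    also have "\<dots> \<le> real (k - 1) * real m" using m_bounds(2) D(2) by (intro mult_left_mono) auto
    also have "\<dots> \<le> real (advice_size A family)"
      using advice_lower_bound[OF that] by (metis of_nat_le_iff of_nat_mult)
    finally show ?thesis .
  qed
  have "port_tree T \<and> \<alpha> * real n \<le> real (tree_size T) \<and>
      real (tree_size T) \<le> (13 + 2 / \<alpha>) * real n \<and> tree_diameter T = D \<and> xi T \<le> enat \<tau>"
    if "T \<in> family" for T
    using that port_tree_T lower upper diam diameter feasible
    unfolding family_def tree_size_def by auto
  then show ?thesis
    unfolding \<tau>_def[symmetric] using finite_family advice by (intro exI[of _ family]) blast
qed

text \<open>The three constants are fixed before \<open>D\<close> and depend on \<alpha>
  only.\<close>

theorem theorem6p1:
  fixes \<alpha> :: real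
  assumes "0 < \<alpha>" and "\<alpha> < 1/2"
  shows "\<exists>c1 c2 c3 :: real. 0 < c1 \<and> 0 < c2 \<and> 0 < c3 \<and>
    (\<forall>D :: nat \<Rightarrow> nat.
       (\<forall>\<^sub>F n in sequentially. 0 < D n \<and> D n < n) \<longrightarrow>
       (\<lambda>n. real (D n)) \<in> \<omega>(\<lambda>n. (log 2 (real n))^2) \<longrightarrow>
       (\<forall>\<^sub>F n in sequentially.
          \<exists>\<T> :: nat port_graph set. finite \<T> \<and> \<T> \<noteq> {} \<and>
            (\<forall>T\<in>\<T>. port_tree T \<and>
               c1 * real n \<le> real (tree_size T) \<and> real (tree_size T) \<le> c2 * real n \<and>
               tree_diameter T = D n \<and>
               xi T \<le> enat (nat \<lfloor>\<alpha> * real (D n)\<rfloor>)) \<and>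
            (\<forall>alg A. works_in_time alg A \<T> (nat \<lfloor>\<alpha> * real (D n)\<rfloor>) \<longrightarrow>
               c3 * real n \<le> real (advice_size A \<T>))))"
proof -
  \<comment> \<open>Half of the smaller gap between \<alpha> and the ends of its range, so that both
    \<open>m \<le> \<tau> / 2\<close> and a sufficiently long leg can be arranged.\<close>
  define \<delta> where "\<delta> = min \<alpha> (1 / 2 - \<alpha>) / 2"
  have \<delta>: "0 < \<delta>" "2 * \<delta> \<le> \<alpha>" "\<alpha> + 2 * \<delta> \<le> 1 / 2" using assms unfolding \<delta>_def by (auto simp: min_def)
  have main: "\<forall>\<^sub>F n in sequentially.
          \<exists>\<T> :: nat port_graph set. finite \<T> \<and> \<T> \<noteq> {} \<and>
            (\<forall>T\<in>\<T>. port_tree T \<and>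
               \<alpha> * real n \<le> real (tree_size T) \<and> real (tree_size T) \<le> (13 + 2 / \<alpha>) * real n \<and>
               tree_diameter T = D n \<and>
               xi T \<le> enat (nat \<lfloor>\<alpha> * real (D n)\<rfloor>)) \<and>
            (\<forall>alg A. works_in_time alg A \<T> (nat \<lfloor>\<alpha> * real (D n)\<rfloor>) \<longrightarrow>
               \<delta> / 4 * real n \<le> real (advice_size A \<T>))"
    if lt: "\<forall>\<^sub>F n in sequentially. 0 < D n \<and> D n < n"
      and om: "(\<lambda>n. real (D n)) \<in> \<omega>(\<lambda>n. (log 2 (real n))^2)" for D
  proof -
    \<comment> \<open>Growth with the constant \<open>1 / \<delta>\<close> gives that the squared
      logarithm is at most \<open>\<delta> * real (D n)\<close>; together with a logarithm of at
      least 3 this yields both lower bounds on \<open>D n\<close>.\<close>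
    have "\<forall>\<^sub>F n in sequentially. norm (real (D n)) \<ge> 1 / \<delta> * norm ((log 2 (real n))^2)"
      using \<delta>(1) by (intro landau_omega.smallD[OF om]) simp
    moreover have "\<forall>\<^sub>F n in sequentially. 3 \<le> log 2 (real n)"
    proof (rule eventually_sequentiallyI)
      fix n :: nat assume "8 \<le> n"
      then have "log 2 8 \<le> log 2 (real n)" by (intro log_mono) auto
      moreover have "log 2 8 = (3 :: real)" using log_pow_cancel[of "2 :: real" 3] by simp
      ultimately show "3 \<le> log 2 (real n)" by simp
    qed
    ultimately show ?thesis using lt
    proof eventually_elim
      case (elim n)
      have "3 * log 2 (real n) \<le> (log 2 (real n))^2"
        using elim(2) unfolding power2_eq_square by (intro mult_right_mono) auto
      moreover have "(log 2 (real n))^2 \<le> \<delta> * real (D n)"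
        using elim(1) \<delta>(1) by (simp add: field_simps)
      moreover have "2 * \<delta> * real (D n) \<le> \<alpha> * real (D n)" using \<delta>(2) by (intro mult_right_mono) auto
      ultimately show ?case
        using elim(2,3) assms(1) \<delta> by (intro spider_parameters) linarith+
    qed
  qed
  show ?thesis
    using assms(1) \<delta>(1) main
    by (intro exI[of _ \<alpha>] exI[of _ "13 + 2 / \<alpha>"] exI[of _ "\<delta> / 4"]) (auto simp: add_pos_pos)
qed

end
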